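(* Let $(e^{tA})_{t\ge0}$ and $(e^{tB})_{t\ge0}$ be real and uniformly asymptotically positive $C_0$-semigroups on a complex Banach lattice $E$. If $(e^{tB})_{t\ge0}$ uniformly asymptotically dominates $(e^{tA})_{t\ge0}$, then $$\sigma(A)\cap(s(B)+i\mathbb R)\subseteq\sigma_{\mathrm{per}}(B).$$
   Context: $s(A):=\sup\{\operatorname{Re}\lambda:\lambda\in\sigma(A)\}$ is the spectral bound; $\sigma_{\mathrm{per}}(B):=\{\lambda\in\sigma(B):\operatorname{Re}\lambda=s(B)\}$. A bounded operator on a complex Banach lattice is real if it maps the real part $E_{\mathbb R}$ into itself; a semigroup is real if all its operators are real. $E_+$ denotes the positive cone. A $C_0$-semigroup $(e^{tA})_{t\ge0}$ on $E$ with $s(A)=0$ is uniformly asymptotically positive if it is bounded and for each $\epsilon>0$ there is $t_0\ge0$ such that $\operatorname{dist}(e^{tA}f,E_+)\le\epsilon\|f\|$ for all $t\ge t_0$ and all $0\le f\in E$. If $s(A)\ne-\infty$ is different from $0$, the semigroup is called uniformly asymptotically positive if the rescaled semigroup $(e^{t(A-s(A))})_{t\ge0}$ is. (In particular $s(A)>-\infty$.) If $(e^{t(B-s(B))})_{t\ge0}$ is bounded (which holds when $(e^{tB})_{t\ge0}$ is uniformly asymptotically positive), then $(e^{tB})_{t\ge0}$ is said to uniformly asymptotically dominate $(e^{tA})_{t\ge0}$ if for each $\epsilon>0$ there is $t_0\ge0$ such that $$\operatorname{dist}\big(e^{t(B-s(B))}f-e^{t(A-s(B))}f,\,E_+\big)\le\epsilon\|f\|$$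 for all $f\in E_+$ and all $t\ge t_0$. *)

theory Defs
  imports "HOL-Analysis.Analysis" "HOL-Library.Lattice_Algebras"
begin

section \<open>Real Banach lattices\<close>

class banach_lattice = banach + ordered_real_vector + lattice_ab_group_add_abs +
  assumes lattice_norm: "\<bar>x\<bar> \<le> \<bar>y\<bar> \<Longrightarrow> norm x \<le> norm y"

instance real :: banach_lattice
  by standard simp

lemma bl_abs_le: "\<bar>x\<bar> \<le> y \<longleftrightarrow> x \<le> y \<and> - x \<le> (y :: 'a :: banach_lattice)"
  by (simp add: abs_lattice)

lemma bl_norm_mono: "\<bar>x\<bar> \<le> y \<Longrightarrow> norm x \<le> norm (y :: 'a :: banach_lattice)"
  by (meson abs_ge_self lattice_norm order_trans)

lemma bl_norm_abs [simp]: "norm \<bar>x :: 'a :: banach_lattice\<bar> = norm x"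
  by (intro antisym lattice_norm) simp_all

lemma bl_abs_scaleR: "\<bar>a *\<^sub>R x\<bar> \<le> \<bar>a\<bar> *\<^sub>R \<bar>x :: 'a :: banach_lattice\<bar>"
proof (cases "a \<ge> 0")
  case True
  then show ?thesis
    using scaleR_left_mono[OF abs_ge_self[of x] True] scaleR_left_mono[OF abs_ge_minus_self[of x] True]
    by (simp add: bl_abs_le)
next
  case False
  then have "0 \<le> - a" by simp
  then show ?thesis
    using scaleR_left_mono[OF abs_ge_self[of x] \<open>0 \<le> - a\<close>]
      scaleR_left_mono[OF abs_ge_minus_self[of x] \<open>0 \<le> - a\<close>] False
    by (simp add: bl_abs_le)
qed

lemma bl_limit_nonneg:
  fixes X :: "nat \<Rightarrow> 'a :: banach_lattice"
  assumes "X \<longlonglongrightarrow> L" and "\<And>n. 0 \<le> X n"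
  shows "0 \<le> L"
proof -
  have "norm (sup (- L) 0) \<le> norm (X n - L)" for n
  proof -
    have "- L \<le> \<bar>X n - L\<bar>"
      using assms(2)[of n] abs_ge_self[of "X n - L"] by (smt (verit) add_increasing diff_conv_add_uminus order_trans order_refl)
    then have "sup (- L) 0 \<le> \<bar>X n - L\<bar>" by simp
    then have "\<bar>sup (- L) 0\<bar> \<le> \<bar>X n - L\<bar>" by simp
    then show ?thesis by (rule lattice_norm)
  qed
  moreover have "(\<lambda>n. norm (X n - L)) \<longlonglongrightarrow> 0"
    using assms(1) by (simp add: LIM_zero tendsto_norm_zero)
  ultimately have "norm (sup (- L) 0) \<le> 0"
    by (meson LIMSEQ_le_const)
  then have "sup (- L) 0 = 0" by simp
  then have "- L \<le> 0" by (metis sup_ge1)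
  then show ?thesis by simp
qed

lemma bl_limit_mono:
  fixes X Y :: "nat \<Rightarrow> 'a :: banach_lattice"
  assumes "X \<longlonglongrightarrow> L" "Y \<longlonglongrightarrow> M" and "\<And>n. X n \<le> Y n"
  shows "L \<le> M"
proof -
  have "0 \<le> M - L"
    by (rule bl_limit_nonneg[OF tendsto_diff[OF assms(2,1)]]) (simp add: assms(3))
  then show ?thesis by simp
qed

section \<open>Complex Banach lattices\<close>

text \<open>A complex Banach lattice is by definition the complexification of a real Banach lattice,
  with the modulus \<open>\<bar>x + i y\<bar> = sup {x cos t + y sin t | t \<in> \<real>}\<close> and the norm \<open>norm \<bar>x + i y\<bar>\<close>.\<close>

datatype 'a complexification = Complexify (Rpart: 'a) (Ipart: 'a)

definition phase_part :: "'a :: banach_lattice complexification \<Rightarrow> real \<Rightarrow> 'a"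
  where "phase_part f t = cos t *\<^sub>R Rpart f + sin t *\<^sub>R Ipart f"

text \<open>The least upper bound exists although \<open>'a\<close> need not be order complete; see
  \<open>modulus_upper\<close> and \<open>modulus_least\<close> below.\<close>

definition modulus :: "'a :: banach_lattice complexification \<Rightarrow> 'a"
  where "modulus f = (LEAST m. \<forall>t. phase_part f t \<le> m)"

lemma phase_part_lipschitz:
  fixes f :: "'a :: banach_lattice complexification"
  shows "phase_part f s \<le> phase_part f t + \<bar>s - t\<bar> *\<^sub>R (\<bar>Rpart f\<bar> + \<bar>Ipart f\<bar>)"
proof -
  have c: "\<bar>cos s - cos t\<bar> \<le> \<bar>s - t\<bar>"
    using abs_sin_x_le_abs_x[of "(t - s) / 2"] abs_sin_le_one[of "(s + t) / 2"]
      mult_mono[of "\<bar>sin ((s + t) / 2)\<bar>" 1 "\<bar>sin ((t - s) / 2)\<bar>" "\<bar>(t - s) / 2\<bar>"]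
    by (simp add: cos_diff_cos abs_mult)
  have d: "\<bar>sin s - sin t\<bar> \<le> \<bar>s - t\<bar>"
    using abs_sin_x_le_abs_x[of "(s - t) / 2"] abs_cos_le_one[of "(s + t) / 2"]
      mult_mono[of "\<bar>cos ((s + t) / 2)\<bar>" 1 "\<bar>sin ((s - t) / 2)\<bar>" "\<bar>(s - t) / 2\<bar>"]
    by (simp add: sin_diff_sin abs_mult mult.commute)
  have e: "a *\<^sub>R z \<le> b *\<^sub>R \<bar>z\<bar>" if "\<bar>a\<bar> \<le> b" for a b :: real and z :: 'a
  proof -
    have "a *\<^sub>R z \<le> \<bar>a *\<^sub>R z\<bar>" by (rule abs_ge_self)
    also have "\<dots> \<le> \<bar>a\<bar> *\<^sub>R \<bar>z\<bar>" by (rule bl_abs_scaleR)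
    also have "\<dots> \<le> b *\<^sub>R \<bar>z\<bar>" using that by (intro scaleR_right_mono) simp_all
    finally show ?thesis .
  qed
  have "phase_part f s =
      phase_part f t + ((cos s - cos t) *\<^sub>R Rpart f + (sin s - sin t) *\<^sub>R Ipart f)"
    by (simp add: phase_part_def algebra_simps)
  also have "\<dots> \<le> phase_part f t + (\<bar>s - t\<bar> *\<^sub>R \<bar>Rpart f\<bar> + \<bar>s - t\<bar> *\<^sub>R \<bar>Ipart f\<bar>)"
    by (intro add_left_mono add_mono e c d)
  finally show ?thesis by (simp add: scaleR_add_right)
qed

lemma phase_part_reduce: "\<exists>s. 0 \<le> s \<and> s \<le> 8 \<and> phase_part f t = phase_part f s"
proof -
  obtain s where "0 \<le> s" "s \<le> 2 * pi" "cos t = cos s" "sin t = sin s"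
    using sincos_total_2pi_le[of "cos t" "sin t"] by auto
  then show ?thesis
    using pi_less_4 by (intro exI[of _ s]) (auto simp: phase_part_def)
qed

lemma modulus_exists: "\<exists>m. (\<forall>t. phase_part f t \<le> m) \<and> (\<forall>u. (\<forall>t. phase_part f t \<le> u) \<longrightarrow> m \<le> u)"
proof -
  define w where "w = \<bar>Rpart f\<bar> + \<bar>Ipart f\<bar>"
  have w: "0 \<le> w" by (simp add: w_def)
  define G where "G n = (\<lambda>k. phase_part f (real k / real (Suc n))) ` {0..8 * Suc n}" for n
  define F where "F n = Sup_fin (G n)" for n
  have G: "finite (G n)" "G n \<noteq> {}" for n by (auto simp: G_def)
  have approx: "phase_part f t \<le> F n + (1 / real (Suc n)) *\<^sub>R w" for t n
  proof -
    obtain s where s: "0 \<le> s" "s \<le> 8" "phase_part f t = phase_part f s"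
      using phase_part_reduce by blast
    define k where "k = nat \<lfloor>s * real (Suc n)\<rfloor>"
    have k0: "real k \<le> s * real (Suc n)" "s * real (Suc n) \<le> real k + 1"
      using s(1) unfolding k_def by (simp_all add: of_nat_nat)
    have "s * real (Suc n) \<le> 8 * real (Suc n)"
      using s(2) by (intro mult_right_mono) simp_all
    then have "real k \<le> real (8 * Suc n)" using k0(1) by simp
    then have "k \<le> 8 * Suc n" by (simp only: of_nat_le_iff)
    then have "phase_part f (real k / real (Suc n)) \<in> G n"
      unfolding G_def by (intro image_eqI[of _ _ k]) auto
    then have 1: "phase_part f (real k / real (Suc n)) \<le> F n"
      unfolding F_def by (rule Sup_fin.coboundedI[OF G(1)])
    have "\<bar>s - real k / real (Suc n)\<bar> \<le> 1 / real (Suc n)"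
    proof -
      have "real k / real (Suc n) \<le> s"
        using k0(1) by (simp only: pos_divide_le_eq of_nat_0_less_iff zero_less_Suc)
      moreover have "s \<le> (real k + 1) / real (Suc n)"
        using k0(2) by (simp only: pos_le_divide_eq of_nat_0_less_iff zero_less_Suc)
      ultimately show ?thesis unfolding add_divide_distrib by linarith
    qed
    then have 2: "\<bar>s - real k / real (Suc n)\<bar> *\<^sub>R w \<le> (1 / real (Suc n)) *\<^sub>R w"
      by (rule scaleR_right_mono[OF _ w])
    show ?thesis
      using phase_part_lipschitz[of f s "real k / real (Suc n)"] add_mono[OF 1 2] s(3)
      unfolding w_def[symmetric] by (metis order_trans)
  qed
  have step: "F m \<le> F n + (1 / real (Suc n)) *\<^sub>R w" for m n
    unfolding F_def[of m] by (rule Sup_fin.boundedI[OF G]) (use approx in \<open>auto simp: G_def\<close>)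
  have bnd: "norm (F m - F n) \<le> (1 / real (Suc m) + 1 / real (Suc n)) * norm w" for m n
  proof -
    have "(1 / real (Suc k)) *\<^sub>R w \<le> (1 / real (Suc m) + 1 / real (Suc n)) *\<^sub>R w"
      if "k = m \<or> k = n" for k
      using that by (intro scaleR_right_mono[OF _ w]) auto
    moreover have "F m - F n \<le> (1 / real (Suc n)) *\<^sub>R w" "F n - F m \<le> (1 / real (Suc m)) *\<^sub>R w"
      using step[of m n] step[of n m] by (simp_all add: algebra_simps)
    ultimately have "\<bar>F m - F n\<bar> \<le> (1 / real (Suc m) + 1 / real (Suc n)) *\<^sub>R w"
      unfolding bl_abs_le by (metis minus_diff_eq order_trans)
    from bl_norm_mono[OF this] show ?thesis by simp
  qed
  have inv0: "(\<lambda>n. 1 / real (Suc n)) \<longlonglongrightarrow> 0"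
    using LIMSEQ_inverse_real_of_nat by (simp add: inverse_eq_divide)
  have "Cauchy F"
  proof (rule metric_CauchyI)
    fix e :: real
    assume "0 < e"
    have "(\<lambda>n. (1 / real (Suc n)) * norm w) \<longlonglongrightarrow> 0"
      using tendsto_mult_right[OF inv0, of "norm w"] by simp
    then obtain N where N: "\<And>n. n \<ge> N \<Longrightarrow> (1 / real (Suc n)) * norm w < e / 2"
      using LIMSEQ_D[of _ 0 "e / 2"] \<open>0 < e\<close> by (fastforce simp: abs_less_iff)
    have "dist (F m) (F n) < e" if "m \<ge> N" "n \<ge> N" for m n
      using bnd[of m n] N[OF that(1)] N[OF that(2)] unfolding dist_norm distrib_right by linarith
    then show "\<exists>M. \<forall>m\<ge>M. \<forall>n\<ge>M. dist (F m) (F n) < e" by blast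
  qed
  then obtain L where L: "F \<longlonglongrightarrow> L" using Cauchy_convergent convergent_def by blast
  have "(\<lambda>n. F n + (1 / real (Suc n)) *\<^sub>R w) \<longlonglongrightarrow> L + 0 *\<^sub>R w"
    by (intro tendsto_intros L inv0)
  then have "phase_part f t \<le> L" for t
    using bl_limit_mono[OF tendsto_const[of "phase_part f t"] _ approx] by simp
  moreover have "L \<le> u" if u: "\<forall>t. phase_part f t \<le> u" for u
  proof (rule bl_limit_mono[OF L tendsto_const])
    fix n
    show "F n \<le> u"
      unfolding F_def by (rule Sup_fin.boundedI[OF G]) (use u in \<open>auto simp: G_def\<close>)
  qed
  ultimately show ?thesis by blast
qed

lemma modulus_upper: "phase_part f t \<le> modulus f"
  and modulus_least: "(\<And>t. phase_part f t \<le> u) \<Longrightarrow> modulus f \<le> u"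
proof -
  obtain m where m: "\<forall>t. phase_part f t \<le> m" "\<And>u. (\<forall>t. phase_part f t \<le> u) \<Longrightarrow> m \<le> u"
    using modulus_exists[of f] by blast
  have "modulus f = m"
    unfolding modulus_def by (rule Least_equality) (use m in auto)
  then show "phase_part f t \<le> modulus f" "(\<And>t. phase_part f t \<le> u) \<Longrightarrow> modulus f \<le> u"
    using m by auto
qed

lemma abs_Rpart_le_modulus: "\<bar>Rpart f\<bar> \<le> modulus f"
  using modulus_upper[of f 0] modulus_upper[of f pi] by (simp add: phase_part_def bl_abs_le)

lemma abs_Ipart_le_modulus: "\<bar>Ipart f\<bar> \<le> modulus f"
  using modulus_upper[of f "pi / 2"] modulus_upper[of f "- (pi / 2)"]
  by (simp add: phase_part_def bl_abs_le)

lemma modulus_nonneg: "0 \<le> modulus f"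
  using abs_Rpart_le_modulus[of f] abs_ge_zero order_trans by blast

lemma modulus_le:
  fixes f :: "'a :: banach_lattice complexification"
  shows "modulus f \<le> \<bar>Rpart f\<bar> + \<bar>Ipart f\<bar>"
proof (rule modulus_least)
  have e: "a *\<^sub>R z \<le> \<bar>z\<bar>" if "\<bar>a\<bar> \<le> 1" for a :: real and z :: 'a
  proof -
    have "a *\<^sub>R z \<le> \<bar>a *\<^sub>R z\<bar>" by (rule abs_ge_self)
    also have "\<dots> \<le> \<bar>a\<bar> *\<^sub>R \<bar>z\<bar>" by (rule bl_abs_scaleR)
    also have "\<dots> \<le> 1 *\<^sub>R \<bar>z\<bar>" using that by (intro scaleR_right_mono) simp_all
    finally show ?thesis by simp
  qed
  show "phase_part f t \<le> \<bar>Rpart f\<bar> + \<bar>Ipart f\<bar>" for t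
    unfolding phase_part_def by (intro add_mono e) simp_all
qed

instantiation complexification :: (banach_lattice) ab_group_add
begin

definition "0 = Complexify 0 0"
definition "f + g = Complexify (Rpart f + Rpart g) (Ipart f + Ipart g)"
definition "- f = Complexify (- Rpart f) (- Ipart f)"
definition "f - g = Complexify (Rpart f - Rpart g) (Ipart f - Ipart g)"

instance
  by standard
    (auto simp: zero_complexification_def plus_complexification_def uminus_complexification_def
      minus_complexification_def complexification.expand)

end

instantiation complexification :: (banach_lattice) real_vector
begin

definition "a *\<^sub>R f = Complexify (a *\<^sub>R Rpart f) (a *\<^sub>R Ipart f)"

instance
  by standard
    (auto simp: plus_complexification_def scaleR_complexification_def algebra_simps
      complexification.expand)

end

lemma complexification_sel [simp]:
  "Rpart 0 = 0" "Ipart 0 = 0"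
  "Rpart (f + g) = Rpart f + Rpart g" "Ipart (f + g) = Ipart f + Ipart g"
  "Rpart (- f) = - Rpart f" "Ipart (- f) = - Ipart f"
  "Rpart (f - g) = Rpart f - Rpart g" "Ipart (f - g) = Ipart f - Ipart g"
  "Rpart (a *\<^sub>R f) = a *\<^sub>R Rpart f" "Ipart (a *\<^sub>R f) = a *\<^sub>R Ipart f"
  by (simp_all add: zero_complexification_def plus_complexification_def
      uminus_complexification_def minus_complexification_def scaleR_complexification_def)

definition scaleC :: "complex \<Rightarrow> 'a :: banach_lattice complexification \<Rightarrow> 'a complexification"
    (infixr \<open>*\<^sub>C\<close> 75)
  where "c *\<^sub>C f = Complexify (Re c *\<^sub>R Rpart f - Im c *\<^sub>R Ipart f) (Re c *\<^sub>R Ipart f + Im c *\<^sub>R Rpart f)"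

lemma scaleC_sel [simp]:
  "Rpart (c *\<^sub>C f) = Re c *\<^sub>R Rpart f - Im c *\<^sub>R Ipart f"
  "Ipart (c *\<^sub>C f) = Re c *\<^sub>R Ipart f + Im c *\<^sub>R Rpart f"
  by (simp_all add: scaleC_def)

lemma scaleC_add_right: "c *\<^sub>C (f + g) = c *\<^sub>C f + c *\<^sub>C g"
  and scaleC_add_left: "(c + d) *\<^sub>C f = c *\<^sub>C f + d *\<^sub>C f"
  and scaleC_scaleC: "c *\<^sub>C d *\<^sub>C f = (c * d) *\<^sub>C f"
  and scaleC_one: "1 *\<^sub>C f = f"
  and scaleC_of_real: "of_real a *\<^sub>C f = a *\<^sub>R f"
  by (rule complexification.expand; simp add: algebra_simps)+

lemma modulus_add: "modulus (f + g) \<le> modulus f + modulus g"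
proof (rule modulus_least)
  fix t
  have "phase_part (f + g) t = phase_part f t + phase_part g t"
    by (simp add: phase_part_def algebra_simps)
  then show "phase_part (f + g) t \<le> modulus f + modulus g"
    by (simp add: add_mono modulus_upper)
qed

lemma modulus_scaleC_le: "modulus (c *\<^sub>C f) \<le> cmod c *\<^sub>R modulus f"
proof (rule modulus_least)
  fix t
  obtain r a where c: "c = rcis r a" "r = cmod c" using rcis_cmod_Arg by metis
  have "phase_part (c *\<^sub>C f) t = r *\<^sub>R phase_part f (t - a)"
    by (simp add: c(1) phase_part_def cos_diff sin_diff algebra_simps)
  also have "\<dots> \<le> r *\<^sub>R modulus f"
    by (rule scaleR_left_mono[OF modulus_upper]) (simp add: c(2))
  finally show "phase_part (c *\<^sub>C f) t \<le> cmod c *\<^sub>R modulus f" by (simp add: c(2))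
qed

lemma modulus_scaleC: "modulus (c *\<^sub>C f) = cmod c *\<^sub>R modulus f"
proof (cases "c = 0")
  case True
  have "modulus (0 *\<^sub>C f) \<le> 0" using modulus_scaleC_le[of 0 f] by simp
  then show ?thesis using True modulus_nonneg[of "0 *\<^sub>C f"] by simp
next
  case False
  then have "modulus f = modulus (inverse c *\<^sub>C c *\<^sub>C f)"
    by (simp add: scaleC_scaleC scaleC_one)
  also have "\<dots> \<le> cmod (inverse c) *\<^sub>R modulus (c *\<^sub>C f)" by (rule modulus_scaleC_le)
  finally have "cmod c *\<^sub>R modulus f \<le> cmod c *\<^sub>R cmod (inverse c) *\<^sub>R modulus (c *\<^sub>C f)"
    by (rule scaleR_left_mono) simp
  then have "cmod c *\<^sub>R modulus f \<le> modulus (c *\<^sub>C f)"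
    using False by (simp add: norm_inverse)
  then show ?thesis using modulus_scaleC_le by (rule antisym[rotated])
qed

lemma modulus_scaleR: "modulus (a *\<^sub>R f) = \<bar>a\<bar> *\<^sub>R modulus f"
  using modulus_scaleC[of "of_real a" f] by (simp add: scaleC_of_real)

instantiation complexification :: (banach_lattice) real_normed_vector
begin

definition "norm f = norm (modulus f)"
definition "dist f g = norm (f - g)" for f g :: "'a complexification"
definition "sgn f = f /\<^sub>R norm f" for f :: "'a complexification"
definition "uniformity = (INF e\<in>{0 <..}. principal {(f, g :: 'a complexification). dist f g < e})"
definition "open U = (\<forall>f\<in>U. \<forall>\<^sub>F (f', g) in uniformity. f' = f \<longrightarrow> g \<in> U)"
  for U :: "'a complexification set"

instance
proof
  fix f g :: "'a complexification" and a :: real and U :: "'a complexification set"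
  show "dist f g = norm (f - g)" by (rule dist_complexification_def)
  show "sgn f = f /\<^sub>R norm f" by (rule sgn_complexification_def)
  show "uniformity = (INF e\<in>{0 <..}. principal {(f, g :: 'a complexification). dist f g < e})"
    by (rule uniformity_complexification_def)
  show "open U = (\<forall>f\<in>U. \<forall>\<^sub>F (f', g) in uniformity. f' = f \<longrightarrow> g \<in> U)"
    by (rule open_complexification_def)
  show "norm f = 0 \<longleftrightarrow> f = 0"
  proof
    assume "norm f = 0"
    then have "modulus f = 0" by (simp add: norm_complexification_def)
    then have "\<bar>Rpart f\<bar> = 0" "\<bar>Ipart f\<bar> = 0"
      using abs_Rpart_le_modulus[of f] abs_Ipart_le_modulus[of f] by simp_all
    then show "f = 0" by (intro complexification.expand) simp
  next
    assume "f = 0"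
    then show "norm f = 0"
      using modulus_le[of f] modulus_nonneg[of f] by (simp add: norm_complexification_def)
  qed
  have "norm (modulus (f + g)) \<le> norm (modulus f + modulus g)"
    by (rule bl_norm_mono) (simp add: modulus_nonneg modulus_add)
  also have "\<dots> \<le> norm (modulus f) + norm (modulus g)" by (rule norm_triangle_ineq)
  finally show "norm (f + g) \<le> norm f + norm g" by (simp add: norm_complexification_def)
  show "norm (a *\<^sub>R f) = \<bar>a\<bar> * norm f"
    by (simp add: norm_complexification_def modulus_scaleR)
qed

end

lemma norm_scaleC: "norm (c *\<^sub>C f) = cmod c * norm f"
  by (simp add: norm_complexification_def modulus_scaleC)

lemma norm_Rpart_le: "norm (Rpart f) \<le> norm f"
  unfolding norm_complexification_def by (rule bl_norm_mono[OF abs_Rpart_le_modulus])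

lemma norm_Ipart_le: "norm (Ipart f) \<le> norm f"
  unfolding norm_complexification_def by (rule bl_norm_mono[OF abs_Ipart_le_modulus])

lemma norm_complexification_le: "norm f \<le> norm (Rpart f) + norm (Ipart f)"
proof -
  have "norm (modulus f) \<le> norm (\<bar>Rpart f\<bar> + \<bar>Ipart f\<bar>)"
    by (rule bl_norm_mono) (simp add: modulus_nonneg modulus_le)
  also have "\<dots> \<le> norm \<bar>Rpart f\<bar> + norm \<bar>Ipart f\<bar>" by (rule norm_triangle_ineq)
  finally show ?thesis by (simp add: norm_complexification_def)
qed

instance complexification :: (banach_lattice) banach
proof
  fix X :: "nat \<Rightarrow> 'a complexification"
  assume X: "Cauchy X"
  have *: "Cauchy (\<lambda>n. p (X n))"
    if p: "\<And>f g. norm (p f - p g) \<le> norm (f - g)" for p :: "'a complexification \<Rightarrow> 'a"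
  proof (rule metric_CauchyI)
    fix e :: real
    assume "0 < e"
    then obtain M where M: "\<forall>m\<ge>M. \<forall>n\<ge>M. dist (X m) (X n) < e"
      using metric_CauchyD[OF X] by blast
    then show "\<exists>M. \<forall>m\<ge>M. \<forall>n\<ge>M. dist (p (X m)) (p (X n)) < e"
      using p le_less_trans unfolding dist_norm by blast
  qed
  have "Cauchy (\<lambda>n. Rpart (X n))" "Cauchy (\<lambda>n. Ipart (X n))"
    by (intro *, metis norm_Rpart_le norm_Ipart_le complexification_sel(7,8))+
  then obtain x y where xy: "(\<lambda>n. Rpart (X n)) \<longlonglongrightarrow> x" "(\<lambda>n. Ipart (X n)) \<longlonglongrightarrow> y"
    by (meson Cauchy_convergent convergent_def)
  have "(\<lambda>n. norm (Rpart (X n) - x) + norm (Ipart (X n) - y)) \<longlonglongrightarrow> 0 + 0"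
    using xy by (intro tendsto_add tendsto_norm_zero LIM_zero)
  then have lim: "(\<lambda>n. norm (Rpart (X n) - x) + norm (Ipart (X n) - y)) \<longlonglongrightarrow> 0"
    by (simp only: add_0_left)
  have "norm (X n - Complexify x y) \<le> norm (Rpart (X n) - x) + norm (Ipart (X n) - y)" for n
    using norm_complexification_le[of "X n - Complexify x y"]
    by (simp only: complexification_sel complexification.sel)
  then have "(\<lambda>n. X n - Complexify x y) \<longlonglongrightarrow> 0"
    by (rule Lim_null_comparison[OF always_eventually[OF allI] lim])
  then have "X \<longlonglongrightarrow> Complexify x y" by (rule LIM_zero_cancel)
  then show "convergent X" by (auto simp: convergent_def)
qed

definition real_part_space :: "'a :: banach_lattice complexification set"
  where "real_part_space = {f. Ipart f = 0}"

definition positive_cone :: "'a :: banach_lattice complexification set"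
  where "positive_cone = {f. Ipart f = 0 \<and> 0 \<le> Rpart f}"

section \<open>Unbounded operators and their spectrum\<close>

text \<open>An operator \<open>A : D(A) \<rightarrow> E\<close> is a partial function with domain \<open>dom A\<close>.\<close>

type_synonym 'a unbounded_op = "'a complexification \<rightharpoonup> 'a complexification"

definition resolvent_set :: "'a :: banach_lattice unbounded_op \<Rightarrow> complex set"
  where "resolvent_set A = {l. let R = (\<lambda>f. l *\<^sub>C f - the (A f)) in
     bij_betw R (dom A) UNIV \<and> bounded_linear (inv_into (dom A) R)}"

definition spectrum :: "'a :: banach_lattice unbounded_op \<Rightarrow> complex set"
  where "spectrum A = - resolvent_set A"

text \<open>Extended real valued, so that an empty spectrum yields \<open>-\<infinity>\<close>.\<close>

definition spectral_bound :: "'a :: banach_lattice unbounded_op \<Rightarrow> ereal"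
  where "spectral_bound A = (SUP l\<in>spectrum A. ereal (Re l))"

definition peripheral_spectrum :: "'a :: banach_lattice unbounded_op \<Rightarrow> complex set"
  where "peripheral_spectrum A = {l \<in> spectrum A. ereal (Re l) = spectral_bound A}"

section \<open>Semigroups\<close>

text \<open>The library type of bounded operators is only real linear, so complex homogeneity is required
  separately. The operator norm is the same as that of the complex linear operator. Values at
  negative times are irrelevant.\<close>

type_synonym 'a operator_family =
  "real \<Rightarrow> 'a complexification \<Rightarrow>\<^sub>L 'a complexification"

definition C0_semigroup :: "'a :: banach_lattice operator_family \<Rightarrow> bool"
  where "C0_semigroup T \<longleftrightarrow>
     (\<forall>t\<ge>0. \<forall>c f. T t (c *\<^sub>C f) = c *\<^sub>C T t f) \<and>
     T 0 = id_blinfun \<and>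
     (\<forall>s\<ge>0. \<forall>t\<ge>0. T (s + t) = T s o\<^sub>L T t) \<and>
     (\<forall>f. ((\<lambda>t. T t f) \<longlongrightarrow> f) (at_right 0))"

definition generator :: "'a :: banach_lattice operator_family \<Rightarrow> 'a unbounded_op"
  where "generator T = (\<lambda>f. let q = (\<lambda>h. (T h f - f) /\<^sub>R h) in
     if \<exists>g. (q \<longlongrightarrow> g) (at_right 0) then Some (Lim (at_right 0) q) else None)"

definition real_semigroup :: "'a :: banach_lattice operator_family \<Rightarrow> bool"
  where "real_semigroup T \<longleftrightarrow> (\<forall>t\<ge>0. \<forall>f\<in>real_part_space. T t f \<in> real_part_space)"

text \<open>If \<open>A\<close> generates \<open>T\<close>, then \<open>rescale T r\<close> is the semigroup \<open>e\<^sup>t\<^sup>(\<^sup>A\<^sup>-\<^sup>r\<^sup>)\<close>.\<close>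

definition rescale :: "'a :: banach_lattice operator_family \<Rightarrow> real \<Rightarrow> 'a operator_family"
  where "rescale T r = (\<lambda>t. exp (- r * t) *\<^sub>R T t)"

definition bounded_semigroup :: "'a :: banach_lattice operator_family \<Rightarrow> bool"
  where "bounded_semigroup T \<longleftrightarrow> bounded (T ` {0..})"

text \<open>The rescaling with \<open>s(A) = 0\<close> is the identity, so the two cases \<open>s(A) = 0\<close> and \<open>s(A) \<noteq> 0\<close>
  are treated by one formula. For generators of \<open>C\<^sub>0\<close>-semigroups always \<open>s(A) < \<infinity>\<close>.\<close>

definition uniformly_asymptotically_positive :: "'a :: banach_lattice operator_family \<Rightarrow> bool"
  where "uniformly_asymptotically_positive T \<longleftrightarrow>
     \<bar>spectral_bound (generator T)\<bar> \<noteq> \<infinity> \<and>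
     (let S = rescale T (real_of_ereal (spectral_bound (generator T))) in
       bounded_semigroup S \<and>
       (\<forall>\<epsilon>>0. \<exists>t0\<ge>0. \<forall>t\<ge>t0. \<forall>f\<in>positive_cone. infdist (S t f) positive_cone \<le> \<epsilon> * norm f))"

text \<open>\<open>uniformly_asymptotically_dominates TB TA\<close>: \<open>TB\<close> dominates \<open>TA\<close>. Both semigroups are
  rescaled by the spectral bound of the generator of the dominating one, i.e.\ the comparison is
  between \<open>e\<^sup>t\<^sup>(\<^sup>B\<^sup>-\<^sup>s\<^sup>(\<^sup>B\<^sup>)\<^sup>)\<close> and \<open>e\<^sup>t\<^sup>(\<^sup>A\<^sup>-\<^sup>s\<^sup>(\<^sup>B\<^sup>)\<^sup>)\<close>.\<close>

definition uniformly_asymptotically_dominates ::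
    "'a :: banach_lattice operator_family \<Rightarrow> 'a operator_family \<Rightarrow> bool"
  where "uniformly_asymptotically_dominates TB TA \<longleftrightarrow>
     \<bar>spectral_bound (generator TB)\<bar> \<noteq> \<infinity> \<and>
     (let s = real_of_ereal (spectral_bound (generator TB)) in
       bounded_semigroup (rescale TB s) \<and>
       (\<forall>\<epsilon>>0. \<exists>t0\<ge>0. \<forall>t\<ge>t0. \<forall>f\<in>positive_cone.
          infdist (rescale TB s t f - rescale TA s t f) positive_cone \<le> \<epsilon> * norm f))"

end

theory Submission
  imports Defs
begin

text \<open>Rescale to \<open>s(B) = 0\<close> and write \<open>S\<close>, \<open>T\<close> for the semigroups of \<open>B\<close>, \<open>A\<close>. If \<open>s(A) > 0\<close>, then
  \<open>e\<^sup>-\<^sup>t\<^sup>s\<^sup>(\<^sup>A\<^sup>)T(t)\<close> tends to \<open>0\<close> in norm, which approximate eigenvectors at boundary points of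
  \<open>\<sigma>(A)\<close> exclude. If \<open>s(A) = 0\<close>, a point \<open>i\<beta> \<in> \<sigma>(A)\<close> lies on the boundary, so there is a unit vector
  \<open>z\<close> with \<open>T(t)z \<approx> e\<^sup>i\<^sup>\<beta>\<^sup>tz\<close> on a long time interval. Up to small errors and for large \<open>t\<close>,
  \<open>\<bar>e\<^sup>-\<^sup>i\<^sup>\<beta>\<^sup>tS(t)z - z\<bar> \<le> (S(t) - T(t))\<bar>z\<bar> \<le> S(t)\<bar>z\<bar> - \<bar>z\<bar>\<close>. Applying a very long
  Cesaro mean \<open>D\<close> of \<open>S\<close> annihilates the right-hand side, while \<open>D\<bar>z\<bar> \<ge> \<bar>z\<bar>\<close>; averaging over \<open>t\<close>
  thus shows that the Cesaro means of \<open>e\<^sup>-\<^sup>i\<^sup>\<beta>\<^sup>tS(t)\<close> do not tend to \<open>0\<close> uniformly, as they would if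
  \<open>i\<beta>\<close> belonged to the resolvent set of \<open>B\<close>. All means are Riemann sums over a grid which is chosen
  after \<open>z\<close>, so that no integration theory is needed.\<close>

section \<open>Almost positive operators\<close>

definition complex_linear :: "('a :: banach_lattice complexification \<Rightarrow>\<^sub>L 'a complexification) \<Rightarrow> bool"
  where "complex_linear L \<longleftrightarrow> (\<forall>c f. L (c *\<^sub>C f) = c *\<^sub>C L f)"

definition real_operator :: "('a :: banach_lattice complexification \<Rightarrow>\<^sub>L 'a complexification) \<Rightarrow> bool"
  where "real_operator L \<longleftrightarrow> complex_linear L \<and> (\<forall>f\<in>real_part_space. L f \<in> real_part_space)"

text \<open>For a real operator this is its action on the underlying real lattice. Projecting with
  \<open>Rpart\<close> makes the formula total, so linearity and the norm bound hold for every
  operator.\<close>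

definition real_restriction :: "('a :: banach_lattice complexification \<Rightarrow>\<^sub>L 'a complexification) \<Rightarrow> 'a \<Rightarrow> 'a"
  where "real_restriction L x = Rpart (L (Complexify x 0))"

lemma complexify_linear:
  "Complexify (x + y) 0 = Complexify x 0 + Complexify y 0"
  "Complexify (x - y) 0 = Complexify x 0 - Complexify y 0"
  "Complexify (a *\<^sub>R x) 0 = a *\<^sub>R Complexify x 0"
  "Complexify 0 0 = 0"
  by (rule complexification.expand; simp)+

lemma norm_complexify_real [simp]: "norm (Complexify x 0) = norm (x :: 'a :: banach_lattice)"
  using norm_complexification_le[of "Complexify x 0"] norm_Rpart_le[of "Complexify x 0"] by simp

lemma norm_modulus [simp]: "norm (modulus f) = norm f"
  by (simp add: norm_complexification_def)

lemma real_restriction_linear: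
  "real_restriction L (x + y) = real_restriction L x + real_restriction L y"
  "real_restriction L (x - y) = real_restriction L x - real_restriction L y"
  "real_restriction L (a *\<^sub>R x) = a *\<^sub>R real_restriction L x"
  "real_restriction L 0 = 0"
  by (simp_all add: real_restriction_def complexify_linear blinfun.add_right blinfun.diff_right
      blinfun.scaleR_right blinfun.zero_right)

lemma real_restriction_sum: "real_restriction L (\<Sum>k\<in>I. x k) = (\<Sum>k\<in>I. real_restriction L (x k))"
  by (induction I rule: infinite_finite_induct) (simp_all add: real_restriction_linear)

lemma real_restriction_diff_left: "real_restriction (L - L') x = real_restriction L x - real_restriction L' x"
  and real_restriction_add_left: "real_restriction (L + L') x = real_restriction L x + real_restriction L' x"
  and real_restriction_scaleR_left: "real_restriction (a *\<^sub>R L) x = a *\<^sub>R real_restriction L x"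
  by (simp_all add: real_restriction_def blinfun.diff_left blinfun.add_left blinfun.scaleR_left)

lemma norm_real_restriction: "norm (real_restriction L x) \<le> norm L * norm x"
  using norm_Rpart_le[of "L (Complexify x 0)"] norm_blinfun[of L "Complexify x 0"]
  by (simp add: real_restriction_def)

lemma real_operator_apply:
  assumes "real_operator L"
  shows "L f = Complexify (real_restriction L (Rpart f)) (real_restriction L (Ipart f))"
proof -
  have f: "f = Complexify (Rpart f) 0 + \<i> *\<^sub>C Complexify (Ipart f) 0"
    by (rule complexification.expand) simp
  have im: "Ipart (L (Complexify x 0)) = 0" for x
    using assms by (auto simp: real_operator_def real_part_space_def)
  have "L f = L (Complexify (Rpart f) 0) + \<i> *\<^sub>C L (Complexify (Ipart f) 0)"
    using assms f unfolding real_operator_def complex_linear_def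
    by (metis blinfun.add_right)
  then show ?thesis
    by (intro complexification.expand) (simp add: im real_restriction_def)
qed

text \<open>A phase part is a real linear combination of \<open>Rpart f\<close> and
  \<open>Ipart f\<close>, and a real operator acts on both separately. This reduces estimates of
  \<open>modulus (L f)\<close> to order estimates in the real lattice.\<close>

lemma phase_part_real_operator:
  "real_operator L \<Longrightarrow> phase_part (L f) t = real_restriction L (phase_part f t)"
  by (subst real_operator_apply) (simp_all add: phase_part_def real_restriction_linear)

lemma real_restriction_compose:
  "real_operator L' \<Longrightarrow>
    real_restriction (L o\<^sub>L L') x = real_restriction L (real_restriction L' x)"
  using real_operator_apply[of L' "Complexify x 0"]
  by (simp add: real_restriction_def[of L] real_restriction_def[of "L o\<^sub>L L'"] real_restriction_linear)

lemma scaleC_diff_right: "c *\<^sub>C (f - g) = c *\<^sub>C f - c *\<^sub>C g"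
  and scaleC_scaleR: "c *\<^sub>C a *\<^sub>R f = a *\<^sub>R c *\<^sub>C f"
  by (rule complexification.expand; simp add: algebra_simps)+

lemma complex_linear_diff: "complex_linear L \<Longrightarrow> complex_linear L' \<Longrightarrow> complex_linear (L - L')"
  by (simp add: complex_linear_def blinfun.diff_left scaleC_diff_right)

lemma complex_linear_scaleR: "complex_linear L \<Longrightarrow> complex_linear (a *\<^sub>R L)"
  by (simp add: complex_linear_def blinfun.scaleR_left scaleC_scaleR)

lemma real_operator_diff: "real_operator L \<Longrightarrow> real_operator L' \<Longrightarrow> real_operator (L - L')"
  by (simp add: real_operator_def complex_linear_diff real_part_space_def blinfun.diff_left)

lemma real_operator_scaleR: "real_operator L \<Longrightarrow> real_operator (a *\<^sub>R L)"
  by (simp add: real_operator_def complex_linear_scaleR real_part_space_def blinfun.scaleR_left)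

text \<open>The distance to the positive cone is replaced by an explicit order error
  \<open>e\<close>, which can be carried through chains of inequalities in the lattice. No sign is
  imposed on \<open>e\<close>.\<close>

definition almost_positive ::
    "real \<Rightarrow> ('a :: banach_lattice complexification \<Rightarrow>\<^sub>L 'a complexification) \<Rightarrow> bool"
  where "almost_positive \<epsilon> L \<longleftrightarrow>
    (\<forall>x\<ge>0. \<exists>e. norm e \<le> \<epsilon> * norm x \<and> - e \<le> real_restriction L x)"

lemma almost_positiveD:
  assumes "almost_positive \<epsilon> L" "0 \<le> x"
  obtains e where "norm e \<le> \<epsilon> * norm x" "- e \<le> real_restriction L x"
  using assms unfolding almost_positive_def by blast

lemma almost_positive_mono:
  "almost_positive \<epsilon> L \<Longrightarrow> \<epsilon> \<le> \<epsilon>' \<Longrightarrow> almost_positive \<epsilon>' L"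
  unfolding almost_positive_def by (meson mult_right_mono norm_ge_zero order_trans)

lemma almost_positive_add:
  assumes "almost_positive \<epsilon> L" "almost_positive \<epsilon>' L'"
  shows "almost_positive (\<epsilon> + \<epsilon>') (L + L')"
  unfolding almost_positive_def
proof (intro allI impI)
  fix x :: 'a assume x: "0 \<le> x"
  obtain e where e: "norm e \<le> \<epsilon> * norm x" "- e \<le> real_restriction L x"
    using almost_positiveD[OF assms(1) x] .
  obtain e' where e': "norm e' \<le> \<epsilon>' * norm x" "- e' \<le> real_restriction L' x"
    using almost_positiveD[OF assms(2) x] .
  have "- (e + e') \<le> real_restriction (L + L') x"
    using add_mono[OF e(2) e'(2)] by (simp add: real_restriction_add_left)
  moreover have "norm (e + e') \<le> (\<epsilon> + \<epsilon>') * norm x"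
    using norm_triangle_ineq[of e e'] e(1) e'(1) by (simp add: distrib_right)
  ultimately show "\<exists>e. norm e \<le> (\<epsilon> + \<epsilon>') * norm x \<and> - e \<le> real_restriction (L + L') x" by blast
qed

text \<open>The infimum defining the distance need not be attained; the factor 2 makes the
  inequality strict, so that some point of the cone realizes it. This fails for
  \<open>x = 0\<close>, which is treated apart.\<close>

lemma almost_positiveI_infdist:
  fixes L :: "'a :: banach_lattice complexification \<Rightarrow>\<^sub>L 'a complexification"
  assumes "0 < \<epsilon>" and "\<And>f. f \<in> positive_cone \<Longrightarrow> infdist (L f) positive_cone \<le> \<epsilon> * norm f"
  shows "almost_positive (2 * \<epsilon>) L"
  unfolding almost_positive_def
proof (intro allI impI)
  fix x :: 'a assume x: "0 \<le> x"
  show "\<exists>e. norm e \<le> 2 * \<epsilon> * norm x \<and> - e \<le> real_restriction L x"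
  proof (cases "x = 0")
    case True
    then show ?thesis by (intro exI[of _ 0]) (simp add: real_restriction_linear)
  next
    case False
    have "(0 :: 'a complexification) \<in> positive_cone" by (simp add: positive_cone_def)
    then have ne: "(positive_cone :: 'a complexification set) \<noteq> {}" by blast
    have "infdist (L (Complexify x 0)) positive_cone \<le> \<epsilon> * norm x"
      using assms(2)[of "Complexify x 0"] x by (simp add: positive_cone_def)
    also have "\<dots> < 2 * \<epsilon> * norm x" using False assms(1) by simp
    finally have "(INF g\<in>positive_cone. dist (L (Complexify x 0)) g) < 2 * \<epsilon> * norm x"
      by (simp add: infdist_notempty[OF ne])
    then obtain g where g: "g \<in> positive_cone" "dist (L (Complexify x 0)) g < 2 * \<epsilon> * norm x"
      using cINF_less_iff[OF ne bdd_belowI2[of _ 0 "dist (L (Complexify x 0))"]] by auto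
    define d where "d = Rpart (L (Complexify x 0) - g)"
    have "norm \<bar>d\<bar> \<le> 2 * \<epsilon> * norm x"
      using g(2) norm_Rpart_le[of "L (Complexify x 0) - g"] by (simp add: d_def dist_norm)
    moreover have "- \<bar>d\<bar> \<le> real_restriction L x"
    proof -
      have "- \<bar>d\<bar> \<le> d" by (subst minus_le_iff) (rule abs_ge_minus_self)
      also have "\<dots> \<le> real_restriction L x"
        using g(1) by (simp add: d_def real_restriction_def positive_cone_def)
      finally show ?thesis .
    qed
    ultimately show ?thesis by blast
  qed
qed

text \<open>By periodicity the phase can be taken in [0, 8], as 8 exceeds 2 pi. It is then rounded
  down to the grid, and the Lipschitz bound controls the loss.\<close>

lemma phase_part_net:
  "\<exists>k\<le>8 * Suc n. phase_part f t \<le> phase_part f (real k / real (Suc n)) +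
     (1 / real (Suc n)) *\<^sub>R (\<bar>Rpart f\<bar> + \<bar>Ipart f\<bar>)"
proof -
  obtain s where s: "0 \<le> s" "s \<le> 8" "phase_part f t = phase_part f s"
    using phase_part_reduce by blast
  define k where "k = nat \<lfloor>s * real (Suc n)\<rfloor>"
  have k0: "real k \<le> s * real (Suc n)" "s * real (Suc n) \<le> real k + 1"
    using s(1) unfolding k_def by (simp_all add: of_nat_nat)
  have "s * real (Suc n) \<le> 8 * real (Suc n)"
    using s(2) by (intro mult_right_mono) simp_all
  then have "real k \<le> real (8 * Suc n)" using k0(1) by simp
  then have k: "k \<le> 8 * Suc n" by (simp only: of_nat_le_iff)
  have "real k / real (Suc n) \<le> s"
    using k0(1) by (simp only: pos_divide_le_eq of_nat_0_less_iff zero_less_Suc)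
  moreover have "s \<le> (real k + 1) / real (Suc n)"
    using k0(2) by (simp only: pos_le_divide_eq of_nat_0_less_iff zero_less_Suc)
  ultimately have "\<bar>s - real k / real (Suc n)\<bar> \<le> 1 / real (Suc n)"
    unfolding add_divide_distrib by linarith
  then have "\<bar>s - real k / real (Suc n)\<bar> *\<^sub>R (\<bar>Rpart f\<bar> + \<bar>Ipart f\<bar>)
      \<le> (1 / real (Suc n)) *\<^sub>R (\<bar>Rpart f\<bar> + \<bar>Ipart f\<bar>)"
    by (rule scaleR_right_mono) simp
  then show ?thesis
    using k order_trans[OF phase_part_lipschitz[of f s "real k / real (Suc n)"] add_left_mono]
    unfolding s(3) by blast
qed

text \<open>The error of almost positivity depends on the phase, so the modulus has to be replaced by a
  supremum over finitely many phases first; \<open>\<epsilon>\<close> is chosen after the number of phases.\<close>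

lemma modulus_almost_positive:
  fixes M \<eta> :: real
  assumes "0 < M" "0 < \<eta>"
  obtains \<epsilon> where "0 < \<epsilon>"
    and "\<And>(L :: 'a :: banach_lattice complexification \<Rightarrow>\<^sub>L 'a complexification) (f :: 'a complexification).
      real_operator L \<Longrightarrow> norm L \<le> M \<Longrightarrow> almost_positive \<epsilon> L \<Longrightarrow>
      \<exists>e. norm e \<le> \<eta> * norm f \<and> modulus (L f) \<le> real_restriction L (modulus f) + e"
proof -
  \<comment> \<open>The mesh makes the loss from rounding the phase at most half of the allowed
    error, given \<open>norm (L f) \<le> M * norm f\<close>.\<close>
  obtain n where n: "4 * M / \<eta> < real n" using reals_Archimedean2 by blast
  define K where "K = {..8 * Suc n}"
  \<comment> \<open>Each phase in \<open>K\<close> contributes an error of norm at most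
    \<open>2 * \<epsilon> * norm f\<close>; summed over \<open>K\<close> this is the other
    half.\<close>
  define \<epsilon> where "\<epsilon> = \<eta> / (4 * real (card K))"
  have K: "finite K" "0 < card K" by (simp_all add: K_def)
  have eps: "0 < \<epsilon>" using assms K by (simp add: \<epsilon>_def)
  have Mn: "2 * M / real (Suc n) \<le> \<eta> / 2"
  proof -
    have "4 * M \<le> \<eta> * real (Suc n)"
      using n assms(2) by (simp add: field_simps)
    then show ?thesis by (simp add: field_simps)
  qed
  show thesis
  proof (rule that[OF eps])
    fix L :: "'a complexification \<Rightarrow>\<^sub>L 'a complexification" and f :: "'a complexification"
    assume L: "real_operator L" "norm L \<le> M" "almost_positive \<epsilon> L"
    define u where "u = modulus f"
    define th where "th k = real k / real (Suc n)" for k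
    have "\<exists>e. norm e \<le> 2 * \<epsilon> * norm f \<and> phase_part (L f) (th k) \<le> real_restriction L u + e" for k
    proof -
      have le: "phase_part f (th k) \<le> u" by (simp add: u_def modulus_upper)
      obtain e where e: "norm e \<le> \<epsilon> * norm (u - phase_part f (th k))"
          "- e \<le> real_restriction L (u - phase_part f (th k))"
        by (rule almost_positiveD[OF L(3), of "u - phase_part f (th k)"]) (use le in simp_all)
      \<comment> \<open>Shifting the phase by pi changes the sign, so the modulus bounds the
        absolute value of each phase part.\<close>
      have "- phase_part f (th k) \<le> u"
        using modulus_upper[of f "th k + pi"] by (simp add: u_def phase_part_def)
      then have "norm (phase_part f (th k)) \<le> norm u"
        using le by (intro bl_norm_mono) (simp add: bl_abs_le)
      then have "norm (u - phase_part f (th k)) \<le> 2 * norm f"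
        using norm_triangle_ineq4[of u "phase_part f (th k)"] by (simp add: u_def)
      then have "\<epsilon> * norm (u - phase_part f (th k)) \<le> \<epsilon> * (2 * norm f)"
        using eps by simp
      then have "norm e \<le> 2 * \<epsilon> * norm f" using e(1) by (simp add: mult_ac)
      moreover have "phase_part (L f) (th k) \<le> real_restriction L u + e"
        using e(2) by (simp add: phase_part_real_operator[OF L(1)] real_restriction_linear algebra_simps)
      ultimately show ?thesis by blast
    qed
    then obtain e where e: "\<And>k. norm (e k) \<le> 2 * \<epsilon> * norm f"
        "\<And>k. phase_part (L f) (th k) \<le> real_restriction L u + e k" by metis
    define w where "w = \<bar>Rpart (L f)\<bar> + \<bar>Ipart (L f)\<bar>"
    \<comment> \<open>One error for all phases: the sum of the absolute values dominates each single
      \<open>e k\<close>, and the last term pays for rounding.\<close>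
    define d where "d = (\<Sum>k\<in>K. \<bar>e k\<bar>) + (1 / real (Suc n)) *\<^sub>R w"
    have "modulus (L f) \<le> real_restriction L u + d"
    proof (rule modulus_least)
      fix t
      obtain k where k: "k \<in> K" "phase_part (L f) t \<le> phase_part (L f) (th k) + (1 / real (Suc n)) *\<^sub>R w"
        using phase_part_net[of n "L f" t] by (auto simp: K_def th_def w_def)
      have "e k \<le> \<bar>e k\<bar>" by (rule abs_ge_self)
      also have "\<dots> \<le> (\<Sum>k\<in>K. \<bar>e k\<bar>)" by (simp add: sum.remove[OF K(1) k(1)] sum_nonneg)
      finally have "real_restriction L u + e k + (1 / real (Suc n)) *\<^sub>R w \<le> real_restriction L u + d"
        by (simp add: d_def add.assoc)
      then show "phase_part (L f) t \<le> real_restriction L u + d"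
        by (rule order_trans[OF order_trans[OF k(2) add_right_mono[OF e(2)]]])
    qed
    moreover have "norm d \<le> \<eta> * norm f"
    proof -
      have "norm (L f) \<le> M * norm f"
        by (rule order_trans[OF norm_blinfun mult_right_mono[OF L(2) norm_ge_zero]])
      then have "norm w \<le> 2 * M * norm f"
        using norm_triangle_ineq[of "\<bar>Rpart (L f)\<bar>" "\<bar>Ipart (L f)\<bar>"]
          norm_Rpart_le[of "L f"] norm_Ipart_le[of "L f"] by (simp add: w_def)
      then have "norm ((1 / real (Suc n)) *\<^sub>R w) \<le> (1 / real (Suc n)) * (2 * M * norm f)"
        unfolding norm_scaleR by (intro mult_mono) auto
      also have "\<dots> = 2 * M / real (Suc n) * norm f" by simp
      also have "\<dots> \<le> \<eta> / 2 * norm f" using Mn by (intro mult_right_mono) auto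
      finally have 1: "norm ((1 / real (Suc n)) *\<^sub>R w) \<le> \<eta> / 2 * norm f" .
      have "norm (\<Sum>k\<in>K. \<bar>e k\<bar>) \<le> (\<Sum>k\<in>K. 2 * \<epsilon> * norm f)"
        using e(1) by (intro sum_norm_le) simp
      also have "\<dots> = \<eta> / 2 * norm f" using K(2) by (simp add: \<epsilon>_def del: card_gt_0_iff)
      finally show ?thesis
        unfolding d_def using 1 norm_triangle_ineq[of "\<Sum>k\<in>K. \<bar>e k\<bar>" "(1 / real (Suc n)) *\<^sub>R w"]
        by linarith
    qed
    ultimately show "\<exists>e. norm e \<le> \<eta> * norm f \<and> modulus (L f) \<le> real_restriction L (modulus f) + e"
      unfolding u_def by blast
  qed
qed

section \<open>Approximate eigenvectors of generators\<close>

lemma bounded_bilinear_scaleC: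
  "bounded_bilinear (scaleC :: complex \<Rightarrow> 'a :: banach_lattice complexification \<Rightarrow> _)"
proof (unfold_locales, goal_cases)
  case (3 r c f)
  show ?case by (rule complexification.expand) (simp add: algebra_simps)
next
  case 5
  show ?case by (rule exI[of _ 1]) (simp add: norm_scaleC)
qed (simp_all add: scaleC_add_right scaleC_add_left scaleC_scaleR)

interpretation scaleC: bounded_bilinear
  "scaleC :: complex \<Rightarrow> 'a :: banach_lattice complexification \<Rightarrow> _"
  by (rule bounded_bilinear_scaleC)

section \<open>Generators and their resolvent sets\<close>

lemma generator_eq_Some:
  "generator T f = Some a \<longleftrightarrow> ((\<lambda>h. (T h f - f) /\<^sub>R h) \<longlongrightarrow> a) (at_right 0)"
  by (auto simp: generator_def Let_def tendsto_Lim intro: tendsto_unique[OF trivial_limit_at_right_real])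

lemma generator_diff:
  assumes "generator T f = Some a" "generator T g = Some b"
  shows "generator T (f - g) = Some (a - b)"
  using tendsto_diff[OF assms[unfolded generator_eq_Some]] unfolding generator_eq_Some
  by (simp add: blinfun.diff_right algebra_simps)

lemma generator_scaleR:
  assumes "generator T f = Some a"
  shows "generator T (r *\<^sub>R f) = Some (r *\<^sub>R a)"
  using tendsto_scaleR[OF tendsto_const[of r] assms[unfolded generator_eq_Some]]
  unfolding generator_eq_Some by (simp add: blinfun.scaleR_right algebra_simps)

lemma generator_add:
  assumes "generator T f = Some a" "generator T g = Some b"
  shows "generator T (f + g) = Some (a + b)"
  using generator_diff[OF assms(1) generator_scaleR[OF assms(2), of "-1"]] by simp

text \<open>A lower bound with constant \<open>c\<close> gives both injectivity and the bound
  \<open>1 / c\<close> for the inverse; conversely the norm bound of the inverse yields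
  \<open>c\<close>. Later arguments can thus work with solutions of the resolvent equation and avoid
  \<open>inv_into\<close>.\<close>

lemma resolvent_set_generator_iff:
  "l \<in> resolvent_set (generator T) \<longleftrightarrow>
    (\<forall>g. \<exists>f a. generator T f = Some a \<and> l *\<^sub>C f - a = g) \<and>
    (\<exists>c>0. \<forall>f a. generator T f = Some a \<longrightarrow> c * norm f \<le> norm (l *\<^sub>C f - a))"
  (is "_ \<longleftrightarrow> ?surj \<and> ?bound")
proof -
  define D where "D = dom (generator T)"
  define R where "R f = l *\<^sub>C f - the (generator T f)" for f
  have R: "f \<in> D \<and> R f = l *\<^sub>C f - a" if "generator T f = Some a" for f a
    using that by (auto simp: D_def R_def)
  have D: "\<exists>a. generator T f = Some a \<and> R f = l *\<^sub>C f - a" if "f \<in> D" for f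
    using that by (auto simp: D_def R_def)
  have rho: "l \<in> resolvent_set (generator T) \<longleftrightarrow>
      bij_betw R D UNIV \<and> bounded_linear (inv_into D R)"
    by (simp add: resolvent_set_def D_def R_def[abs_def] Let_def)
  show ?thesis
  proof
    assume "l \<in> resolvent_set (generator T)"
    then have bij: "bij_betw R D UNIV" and lin: "bounded_linear (inv_into D R)"
      by (simp_all add: rho)
    have ?surj
    proof
      fix g
      have "g \<in> R ` D" using bij by (simp add: bij_betw_def)
      then show "\<exists>f a. generator T f = Some a \<and> l *\<^sub>C f - a = g" using D by fastforce
    qed
    moreover have ?bound
    proof -
      obtain K where K: "K > 0" "\<And>g. norm (inv_into D R g) \<le> norm g * K"
        using bounded_linear.pos_bounded[OF lin] by blast
      have "1 / K * norm f \<le> norm (l *\<^sub>C f - a)" if "generator T f = Some a" for f a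
      proof -
        have "f \<in> D" "R f = l *\<^sub>C f - a" using R[OF that] by auto
        moreover from this bij have "inv_into D R (R f) = f"
          unfolding bij_betw_def by (blast intro: inv_into_f_f)
        ultimately have "norm f \<le> norm (l *\<^sub>C f - a) * K" using K(2)[of "R f"] by metis
        then show ?thesis using K(1) by (simp add: pos_divide_le_eq)
      qed
      then show ?thesis using K(1) by (intro exI[of _ "1 / K"]) simp
    qed
    ultimately show "?surj \<and> ?bound" ..
  next
    assume asm: "?surj \<and> ?bound"
    then obtain c where c: "c > 0"
        "\<And>f a. generator T f = Some a \<Longrightarrow> c * norm f \<le> norm (l *\<^sub>C f - a)" by blast
    have inj: "inj_on R D"
    proof (rule inj_onI)
      fix f g assume fg: "f \<in> D" "g \<in> D" "R f = R g"
      obtain a b where ab: "generator T f = Some a" "R f = l *\<^sub>C f - a"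
          "generator T g = Some b" "R g = l *\<^sub>C g - b"
        using D fg(1,2) by metis
      have "c * norm (f - g) \<le> norm (R f - R g)"
        using c(2)[OF generator_diff[OF ab(1,3)]]
        by (simp add: ab(2,4) scaleC_diff_right algebra_simps)
      then have "c * norm (f - g) \<le> 0" using fg(3) by simp
      then have "norm (f - g) \<le> 0" using c(1) by (simp add: mult_le_0_iff)
      then show "f = g" by simp
    qed
    have surj: "R ` D = UNIV"
    proof -
      have "g \<in> R ` D" for g
      proof -
        obtain f a where "generator T f = Some a" "l *\<^sub>C f - a = g" using asm by blast
        then show ?thesis using R[of f a] by (metis image_eqI)
      qed
      then show ?thesis by blast
    qed
    have inv: "inv_into D R g \<in> D" "R (inv_into D R g) = g" for g
      using surj by (simp_all add: inv_into_into f_inv_into_f)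
    have "bounded_linear (inv_into D R)"
    proof (rule bounded_linear_intro[of _ "1 / c"])
      fix g h r
      obtain a b where ab: "generator T (inv_into D R g) = Some a" "l *\<^sub>C inv_into D R g - a = g"
          "generator T (inv_into D R h) = Some b" "l *\<^sub>C inv_into D R h - b = h"
        using D inv by metis
      have "inv_into D R g + inv_into D R h \<in> D"
          "R (inv_into D R g + inv_into D R h) = g + h"
        using R[OF generator_add[OF ab(1,3)]] ab(2,4)
        by (simp_all add: scaleC_add_right) (simp add: algebra_simps)
      then show "inv_into D R (g + h) = inv_into D R g + inv_into D R h"
        using inv_into_f_eq[OF inj] by blast
      have "r *\<^sub>R inv_into D R g \<in> D" "R (r *\<^sub>R inv_into D R g) = r *\<^sub>R g"
        using R[OF generator_scaleR[OF ab(1), of r]] ab(2)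
        by (simp_all add: scaleC_scaleR flip: scaleR_diff_right)
      then show "inv_into D R (r *\<^sub>R g) = r *\<^sub>R inv_into D R g"
        using inv_into_f_eq[OF inj] by blast
      show "norm (inv_into D R g) \<le> norm g * (1 / c)"
        using c(2)[OF ab(1)] c(1) ab(2) by (simp add: field_simps)
    qed
    then show "l \<in> resolvent_set (generator T)"
      using inj surj by (simp add: rho bij_betw_def)
  qed
qed

text \<open>A Neumann series argument, in the form of a fixed point iteration.\<close>

lemma resolvent_set_perturb:
  assumes mu: "\<mu> \<in> resolvent_set (generator T)" and "0 < c"
    and c: "\<And>f a. generator T f = Some a \<Longrightarrow> c * norm f \<le> norm (\<mu> *\<^sub>C f - a)"
    and l: "cmod (l - \<mu>) \<le> c / 2"
  shows "l \<in> resolvent_set (generator T)"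
  unfolding resolvent_set_generator_iff
proof (intro conjI allI exI[of _ "c / 2"] impI)
  have "\<exists>f a. generator T f = Some a \<and> \<mu> *\<^sub>C f - a = g" for g
    using mu unfolding resolvent_set_generator_iff by blast
  then obtain r a where r: "\<And>g. generator T (r g) = Some (a g)" "\<And>g. \<mu> *\<^sub>C r g - a g = g"
    by metis
  have lip: "c * norm (r g - r h) \<le> norm (g - h)" for g h
  proof -
    have "\<mu> *\<^sub>C (r g - r h) - (a g - a h) = (\<mu> *\<^sub>C r g - a g) - (\<mu> *\<^sub>C r h - a h)"
      by (simp add: scaleC_diff_right)
    then have "\<mu> *\<^sub>C (r g - r h) - (a g - a h) = g - h" by (simp only: r(2))
    then show ?thesis using c[OF generator_diff[OF r(1)[of g] r(1)[of h]]] by simp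
  qed
  fix g
  \<comment> \<open>A fixed point \<open>f\<close> solves the resolvent equation at
    \<open>\<mu>\<close> with right-hand side \<open>g - (l - \<mu>) *\<^sub>C f\<close>, which is
    the equation at \<open>l\<close> with right-hand side \<open>g\<close>. By \<open>lip\<close>,
    \<open>F\<close> contracts with factor 1/2.\<close>
  define F where "F f = r (g - (l - \<mu>) *\<^sub>C f)" for f
  have "dist (F f) (F f') \<le> 1 / 2 * dist f f'" for f f'
  proof -
    have "(g - (l - \<mu>) *\<^sub>C f) - (g - (l - \<mu>) *\<^sub>C f') = (l - \<mu>) *\<^sub>C (f' - f)"
      by (simp add: scaleC_diff_right)
    then have "c * norm (F f - F f') \<le> cmod (l - \<mu>) * norm (f - f')"
      using lip[of "g - (l - \<mu>) *\<^sub>C f" "g - (l - \<mu>) *\<^sub>C f'"]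
      by (simp only: F_def norm_scaleC norm_minus_commute[of f' f])
    also have "\<dots> \<le> c / 2 * norm (f - f')" using l by (intro mult_right_mono) auto
    finally show ?thesis using \<open>0 < c\<close> by (simp add: dist_norm field_simps)
  qed
  then have "\<exists>!f. F f = f"
    by (intro banach_fix_type[of "1 / 2"]) auto
  then obtain f where f: "F f = f" by blast
  have "generator T f = Some (a (g - (l - \<mu>) *\<^sub>C f))"
    using r(1)[of "g - (l - \<mu>) *\<^sub>C f"] f by (simp add: F_def)
  moreover have "\<mu> *\<^sub>C f - a (g - (l - \<mu>) *\<^sub>C f) = g - (l - \<mu>) *\<^sub>C f"
    using r(2)[of "g - (l - \<mu>) *\<^sub>C f"] f by (simp add: F_def)
  then have "l *\<^sub>C f - a (g - (l - \<mu>) *\<^sub>C f) = g"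
    by (simp add: scaleC.diff_left algebra_simps)
  ultimately show "\<exists>f a. generator T f = Some a \<and> l *\<^sub>C f - a = g" by blast
next
  fix f a assume "generator T f = Some a"
  have "\<mu> *\<^sub>C f - a = (l *\<^sub>C f - a) - (l - \<mu>) *\<^sub>C f"
    by (simp add: scaleC.diff_left)
  then have "norm (\<mu> *\<^sub>C f - a) \<le> norm (l *\<^sub>C f - a) + cmod (l - \<mu>) * norm f"
    by (metis norm_scaleC norm_triangle_ineq4)
  also have "cmod (l - \<mu>) * norm f \<le> c / 2 * norm f" using l by (intro mult_right_mono) auto
  finally show "c / 2 * norm f \<le> norm (l *\<^sub>C f - a)"
    using c[OF \<open>generator T f = Some a\<close>] by simp
qed (use \<open>0 < c\<close> in simp)

lemma open_resolvent_set: "open (resolvent_set (generator T))"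
  unfolding open_dist
proof
  fix \<mu> assume mu: "\<mu> \<in> resolvent_set (generator T)"
  then obtain c where c: "c > 0"
      "\<And>f a. generator T f = Some a \<Longrightarrow> c * norm f \<le> norm (\<mu> *\<^sub>C f - a)"
    unfolding resolvent_set_generator_iff by blast
  then show "\<exists>e>0. \<forall>l. dist l \<mu> < e \<longrightarrow> l \<in> resolvent_set (generator T)"
    by (intro exI[of _ "c / 2"] conjI allI impI resolvent_set_perturb[OF mu c])
      (simp_all add: dist_norm)
qed

text \<open>Without such vectors \<open>l - A\<close> is bounded below by \<open>\<delta>\<close>.
  At a nearby resolvent point the lower bound is then almost as good, and the perturbation lemma
  places \<open>l\<close> itself in the resolvent set.\<close>

lemma approximate_eigenvector:
  assumes "l \<in> spectrum (generator T)" and "l \<in> closure (resolvent_set (generator T))" and "0 < \<delta>"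
  shows "\<exists>f a. generator T f = Some a \<and> norm f = 1 \<and> norm (l *\<^sub>C f - a) < \<delta>" (is ?ex)
proof (rule ccontr)
  assume contr: "\<not> ?ex"
  have unit: "\<delta> \<le> norm (l *\<^sub>C f - a)" if f: "generator T f = Some a" "norm f = 1" for f a
    using contr f by (meson not_le)
  have low: "\<delta> * norm f \<le> norm (l *\<^sub>C f - a)" if "generator T f = Some a" for f a
  proof (cases "f = 0")
    case False
    have "l *\<^sub>C (1 / norm f) *\<^sub>R f - (1 / norm f) *\<^sub>R a = (1 / norm f) *\<^sub>R (l *\<^sub>C f - a)"
      by (simp add: scaleC_scaleR scaleR_diff_right)
    then have "\<delta> \<le> norm (l *\<^sub>C f - a) / norm f"
      using unit[OF generator_scaleR[OF that, of "1 / norm f"]] False by simp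
    then show ?thesis using False by (simp add: field_simps)
  qed simp
  \<comment> \<open>At distance below \<open>\<delta> / 3\<close> the lower bound is still
    \<open>2 * \<delta> / 3\<close>, and half of it is exactly the radius required for the
    perturbation.\<close>
  obtain \<mu> where mu: "\<mu> \<in> resolvent_set (generator T)" "dist \<mu> l < \<delta> / 3"
    using assms(2,3) unfolding closure_approachable by (meson divide_pos_pos zero_less_numeral)
  have "2 * \<delta> / 3 * norm f \<le> norm (\<mu> *\<^sub>C f - a)" if "generator T f = Some a" for f a
  proof -
    have "l *\<^sub>C f - a = (\<mu> *\<^sub>C f - a) - (\<mu> - l) *\<^sub>C f"
      by (simp add: scaleC.diff_left)
    then have "norm (l *\<^sub>C f - a) \<le> norm (\<mu> *\<^sub>C f - a) + cmod (\<mu> - l) * norm f"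
      by (metis norm_scaleC norm_triangle_ineq4)
    also have "cmod (\<mu> - l) * norm f \<le> \<delta> / 3 * norm f"
      using mu(2) by (intro mult_right_mono) (auto simp: dist_norm)
    finally show ?thesis using low[OF that] by (simp add: field_simps)
  qed
  then have "l \<in> resolvent_set (generator T)"
    using mu assms(3)
    by (intro resolvent_set_perturb[OF mu(1), of "2 * \<delta> / 3"]) (auto simp: dist_norm norm_minus_commute)
  then show False using assms(1) by (simp add: spectrum_def)
qed

section \<open>Telescoping sums for the semigroup generated by \<open>A - l\<close>\<close>

text \<open>The semigroup generated by \<open>A - l\<close>.\<close>

definition twist :: "complex \<Rightarrow> 'a :: banach_lattice operator_family \<Rightarrow> real
    \<Rightarrow> 'a complexification \<Rightarrow> 'a complexification"
  where "twist l T t f = exp (- l * of_real t) *\<^sub>C T t f"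

lemma twist_diff_right: "twist l T t (f - g) = twist l T t f - twist l T t g"
  and twist_scaleR_right: "twist l T t (r *\<^sub>R f) = r *\<^sub>R twist l T t f"
  by (simp_all add: twist_def blinfun.diff_right blinfun.scaleR_right scaleC_diff_right scaleC_scaleR)

lemma twist_0: "C0_semigroup T \<Longrightarrow> twist l T 0 f = f"
  by (simp add: C0_semigroup_def twist_def scaleC_one)

lemma twist_add:
  assumes "C0_semigroup T" "0 \<le> s" "0 \<le> t"
  shows "twist l T (s + t) f = twist l T s (twist l T t f)"
  using assms by (simp add: C0_semigroup_def twist_def scaleC_scaleC distrib_left exp_add exp_diff
      exp_minus divide_inverse)

text \<open>Discrete form of the identity that the integral of the twisted orbit of
  \<open>(l - A) f\<close> over [0, t] equals \<open>f\<close> minus its value at time t. After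
  division by \<open>h\<close> the summands approximate that orbit.\<close>

lemma twist_telescope:
  assumes "C0_semigroup T" "0 \<le> h"
  shows "(\<Sum>k<n. twist l T (real k * h) (f - twist l T h f)) = f - twist l T (real n * h) f"
proof (induction n)
  case 0
  then show ?case by (simp add: twist_0[OF assms(1)])
next
  case (Suc n)
  have "twist l T (real (Suc n) * h) f = twist l T (real n * h) (twist l T h f)"
    using twist_add[OF assms(1), of "real n * h" h l f] assms(2) by (simp add: algebra_simps)
  moreover have "twist l T (real n * h) (f - twist l T h f)
      = twist l T (real n * h) f - twist l T (real n * h) (twist l T h f)"
    by (rule twist_diff_right)
  ultimately show ?case using Suc by simp
qed

lemma twist_difference_quotient:
  assumes T: "C0_semigroup T" and gen: "generator T f = Some a"
  shows "((\<lambda>h. (f - twist l T h f) /\<^sub>R h) \<longlongrightarrow> l *\<^sub>C f - a) (at_right 0)"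
proof -
  have q: "((\<lambda>h. (T h f - f) /\<^sub>R h) \<longlongrightarrow> a) (at_right 0)"
    using gen by (simp add: generator_eq_Some)
  have "DERIV (\<lambda>z. exp (- l * z)) 0 :> - l"
    by (auto intro!: derivative_eq_intros)
  then have lim: "((\<lambda>z. (exp (- l * z) - 1) / z) \<longlongrightarrow> - l) (at 0)"
    by (simp add: DERIV_def)
  have "filterlim (complex_of_real) (at 0) (at_right 0)"
  proof (rule filterlim_atI)
    show "((\<lambda>h. complex_of_real h) \<longlongrightarrow> 0) (at_right 0)"
      using tendsto_of_real[OF tendsto_ident_at[of 0 "{0<..}"]] by simp
    show "\<forall>\<^sub>F h in at_right 0. complex_of_real h \<noteq> 0"
      by (simp add: eventually_at_filter)
  qed
  then have "((\<lambda>h. - ((exp (- l * of_real h) - 1) / of_real h)) \<longlongrightarrow> - (- l)) (at_right 0)"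
    by (rule tendsto_minus[OF filterlim_compose[OF lim]])
  moreover have "- ((exp (- l * of_real h) - 1) / of_real h) = (1 - exp (- l * of_real h)) /\<^sub>R h"
    for h :: real
    by (simp add: scaleR_conv_of_real divide_inverse algebra_simps)
  ultimately have d: "((\<lambda>h. (1 - exp (- l * of_real h)) /\<^sub>R h) \<longlongrightarrow> l) (at_right 0)"
    by simp
  have e: "((\<lambda>h::real. exp (- l * of_real h)) \<longlongrightarrow> exp (- l * of_real 0)) (at_right 0)"
    by (intro tendsto_intros)
  \<comment> \<open>Product rule: \<open>f - twist l T h f\<close> is split into the change of the
    exponential factor on \<open>f\<close> and the damped increment of \<open>T h f\<close>.\<close>
  have "((\<lambda>h. ((1 - exp (- l * of_real h)) /\<^sub>R h) *\<^sub>C f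
        - exp (- l * of_real h) *\<^sub>C ((T h f - f) /\<^sub>R h)) \<longlongrightarrow> l *\<^sub>C f - 1 *\<^sub>C a) (at_right 0)"
    using e by (intro tendsto_diff scaleC.tendsto d q tendsto_const) simp_all
  then show ?thesis
    by (simp add: scaleC_one twist_def scaleC.scaleR_left scaleC.diff_left scaleC_scaleR
        scaleC_diff_right flip: scaleR_diff_right)
qed

lemma filterlim_step: "0 < t \<Longrightarrow> filterlim (\<lambda>n. t / real n) (at_right 0) sequentially"
  unfolding filterlim_at_right_to_top[symmetric]
  by (intro tendsto_imp_filterlim_at_right tendsto_divide_0[OF tendsto_const]
      filterlim_mono[OF filterlim_real_sequentially] eventually_sequentiallyI[of 1])
    (auto intro: at_top_le_at_infinity)

text \<open>The telescoping sum with step \<open>t / n\<close> has \<open>n\<close> terms, each at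
  most \<open>M\<close> times the first increment; letting \<open>n\<close> grow turns the
  difference quotient into \<open>l *\<^sub>C f - a\<close>. A small eigenvector defect thus stays
  small on all of [0, t].\<close>

lemma norm_diff_twist_le:
  assumes T: "C0_semigroup T" and gen: "generator T f = Some a" and t: "0 \<le> t"
    and M: "\<And>s g. 0 \<le> s \<Longrightarrow> s \<le> t \<Longrightarrow> norm (twist l T s g) \<le> M * norm g"
  shows "norm (f - twist l T t f) \<le> M * t * norm (l *\<^sub>C f - a)"
proof (cases "t = 0")
  case True
  then show ?thesis by (simp add: twist_0[OF T])
next
  case False
  with t have "0 < t" by simp
  have "((\<lambda>n. (f - twist l T (t / real n) f) /\<^sub>R (t / real n)) \<longlongrightarrow> l *\<^sub>C f - a) sequentially"
    by (rule filterlim_compose[OF twist_difference_quotient[OF T gen] filterlim_step[OF \<open>0 < t\<close>]])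
  then have lim: "((\<lambda>n. M * t * norm ((f - twist l T (t / real n) f) /\<^sub>R (t / real n)))
      \<longlongrightarrow> M * t * norm (l *\<^sub>C f - a)) sequentially"
    by (intro tendsto_intros)
  have le: "norm (f - twist l T t f) \<le> M * t * norm ((f - twist l T (t / real n) f) /\<^sub>R (t / real n))"
    if "1 \<le> n" for n
  proof -
    define h where "h = t / real n"
    have h: "0 < h" "real n * h = t" using \<open>0 < t\<close> that by (auto simp: h_def)
    have "norm (f - twist l T t f) \<le> (\<Sum>k<n. M * norm (f - twist l T h f))"
    proof -
      have "real k * h \<le> t" if "k < n" for k
        using h that mult_right_mono[of "real k" "real n" h] by simp
      then show ?thesis
        unfolding h(2)[symmetric] twist_telescope[OF T less_imp_le[OF h(1)], symmetric]
        using h by (intro sum_norm_le M) auto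
    qed
    also have "\<dots> = M * t * norm ((f - twist l T h f) /\<^sub>R h)"
    proof -
      have "norm ((f - twist l T h f) /\<^sub>R h) = norm (f - twist l T h f) / h"
        using h by (simp only: norm_scaleR) (simp add: divide_inverse)
      then show ?thesis using h(1) by (simp flip: h(2))
    qed
    finally show ?thesis by (simp add: h_def)
  qed
  show ?thesis
    by (rule LIMSEQ_le_const[OF lim]) (use le in blast)
qed

text \<open>Means of orbits starting in the range of \<open>l - A\<close> decay like
  \<open>1 / t\<close>. Replacing \<open>l *\<^sub>C f - a\<close> by the difference quotient costs
  at most \<open>\<delta>\<close> per summand once the grid is fine; the remaining sum telescopes,
  and \<open>1 / h = n / t\<close>.\<close>

lemma mean_twist_le:
  assumes T: "C0_semigroup T" and gen: "generator T f = Some a" and t: "0 < t" "0 < \<delta>" and "0 < M"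
    and M: "\<And>s g. 0 \<le> s \<Longrightarrow> norm (twist l T s g) \<le> M * norm g"
  shows "\<forall>\<^sub>F n in sequentially. norm (\<Sum>k<n. twist l T (real k * (t / real n)) (l *\<^sub>C f - a))
    \<le> real n * ((1 + M) * norm f / t + \<delta>)"
proof -
  have "((\<lambda>n. (f - twist l T (t / real n) f) /\<^sub>R (t / real n)) \<longlongrightarrow> l *\<^sub>C f - a) sequentially"
    by (rule filterlim_compose[OF twist_difference_quotient[OF T gen] filterlim_step[OF t(1)]])
  then have "\<forall>\<^sub>F n in sequentially.
      dist ((f - twist l T (t / real n) f) /\<^sub>R (t / real n)) (l *\<^sub>C f - a) < \<delta> / M"
    using t(2) \<open>0 < M\<close> by (intro tendstoD) auto
  then show ?thesis
    using eventually_ge_at_top[of 1]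
  proof eventually_elim
    case (elim n)
    define h where "h = t / real n"
    have h: "0 < h" "real n * h = t" "1 \<le> n" using t elim by (auto simp: h_def)
    define y where "y = (f - twist l T h f) /\<^sub>R h"
    define z where "z = l *\<^sub>C f - a"
    have "(\<Sum>k<n. twist l T (real k * h) z)
        = (\<Sum>k<n. twist l T (real k * h) (z - y)) + (\<Sum>k<n. twist l T (real k * h) y)"
      by (simp add: twist_diff_right flip: sum.distrib)
    moreover have "(\<Sum>k<n. twist l T (real k * h) y) = (f - twist l T t f) /\<^sub>R h"
      using twist_telescope[OF T less_imp_le[OF h(1)], where n = n and l = l and f = f]
      by (simp add: y_def twist_scaleR_right h(2) flip: scaleR_sum_right)
    moreover have "norm (\<Sum>k<n. twist l T (real k * h) (z - y)) \<le> (\<Sum>k<n. \<delta>)"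
    proof (intro sum_norm_le)
      fix k
      have "norm (twist l T (real k * h) (z - y)) \<le> M * norm (z - y)"
        using h by (intro M) auto
      also have "\<dots> \<le> M * (\<delta> / M)"
        using elim(1) \<open>0 < M\<close> by (intro mult_left_mono)
          (auto simp: dist_norm y_def z_def h_def norm_minus_commute)
      finally show "norm (twist l T (real k * h) (z - y)) \<le> \<delta>" using \<open>0 < M\<close> by simp
    qed
    moreover have "norm ((f - twist l T t f) /\<^sub>R h) \<le> real n * ((1 + M) * norm f / t)"
    proof -
      have "norm (f - twist l T t f) \<le> (1 + M) * norm f"
        using norm_triangle_ineq4[of f "twist l T t f"] M[of t f] t by (simp add: distrib_right)
      then have "norm (f - twist l T t f) / h \<le> (1 + M) * norm f / h"
        using h by (intro divide_right_mono) auto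
      then show ?thesis using h t by (simp add: h_def divide_inverse mult_ac)
    qed
    ultimately have "norm (\<Sum>k<n. twist l T (real k * h) z) \<le> real n * \<delta> + real n * ((1 + M) * norm f / t)"
      using norm_triangle_ineq[of "\<Sum>k<n. twist l T (real k * h) (z - y)" "(f - twist l T t f) /\<^sub>R h"]
      by simp
    then show ?case by (simp add: h_def z_def algebra_simps)
  qed
qed

section \<open>Asymptotic domination\<close>

lemma modulus_minus [simp]: "modulus (- f) = modulus f"
  using modulus_scaleR[of "-1" f] by simp

lemma modulus_diff_le: "modulus (f - g) \<le> modulus f + modulus g"
  using modulus_add[of f "- g"] by simp

lemma modulus_sum: "modulus (\<Sum>k\<in>I. f k) \<le> (\<Sum>k\<in>I. modulus (f k))"
proof (induction I rule: infinite_finite_induct)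
  case (insert k I)
  then show ?case
    using order_trans[OF modulus_add add_left_mono[OF insert.IH]] by simp
qed (simp_all add: modulus_scaleR[of 0 0, simplified])

lemma norm_le_of_nonneg_le: "0 \<le> x \<Longrightarrow> x \<le> y \<Longrightarrow> norm x \<le> norm (y :: 'a :: banach_lattice)"
  by (rule bl_norm_mono) simp

text \<open>Shifting the window of summation by one changes only its two end terms, at cost
  \<open>2 * M\<close>. This is why long Cesaro means nearly annihilate differences
  \<open>P u - u\<close>.\<close>

lemma norm_shifted_sum_diff_le:
  fixes v :: "nat \<Rightarrow> 'a :: real_normed_vector"
  assumes "\<And>j. norm (v j) \<le> M"
  shows "norm (\<Sum>j<N. v (j + k) - v j) \<le> real k * (2 * M)"
proof (induction k)
  case (Suc k)
  have "(\<Sum>j<N. v (j + Suc k) - v j)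
      = (\<Sum>j<N. v (j + k) - v j) + (\<Sum>j<N. v (Suc j + k) - v (j + k))"
    by (simp flip: sum.distrib)
  also have "(\<Sum>j<N. v (Suc j + k) - v (j + k)) = v (N + k) - v k"
    using sum_lessThan_telescope[of "\<lambda>j. v (j + k)" N] by simp
  also have "norm ((\<Sum>j<N. v (j + k) - v j) + (v (N + k) - v k)) \<le> real k * (2 * M) + (M + M)"
    by (intro order_trans[OF norm_triangle_ineq] add_mono Suc order_trans[OF norm_triangle_ineq4] assms)
  finally show ?case by (simp add: algebra_simps)
qed simp

text \<open>At most \<open>a / h + 1\<close> grid points lie below \<open>a\<close>. This controls
  the early times, for which only crude bounds are available.\<close>

lemma sum_few_large_le:
  fixes a h B :: real
  assumes "0 < h" "0 \<le> a" "0 \<le> B"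
  shows "(\<Sum>k<n. if real k * h < a then B else 0) \<le> (a / h + 1) * B"
proof -
  have "{k. k < n \<and> real k * h < a} \<subseteq> {..<nat \<lceil>a / h\<rceil>}"
    using assms by (auto simp: less_ceiling_iff zless_nat_eq_int_zless pos_less_divide_eq)
  then have "card {k. k < n \<and> real k * h < a} \<le> nat \<lceil>a / h\<rceil>"
    using card_mono[of "{..<nat \<lceil>a / h\<rceil>}"] by fastforce
  moreover have "real (nat \<lceil>a / h\<rceil>) \<le> a / h + 1"
    using assms by (simp add: of_nat_nat)
  ultimately have "real (card {k. k < n \<and> real k * h < a}) * B \<le> (a / h + 1) * B"
    using assms by (intro mult_right_mono) linarith+
  moreover have "(\<Sum>k<n. if real k * h < a then B else 0) = real (card {k. k < n \<and> real k * h < a}) * B"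
    by (simp add: sum.If_cases Int_def)
  ultimately show ?thesis by simp
qed

text \<open>The order of choices matters: \<open>\<delta>\<close>, then \<open>\<epsilon>\<close>
  and \<open>t0\<close>, then the lengths \<open>\<tau>\<close> and \<open>\<tau>m\<close>, then the
  approximate eigenvector \<open>z\<close>, and last the grid size \<open>n\<close>. Hence
  \<open>K\<close> in \<open>mean\<close> must be independent of \<open>z\<close>, while the
  threshold for \<open>n\<close> may depend on \<open>z\<close>.\<close>

lemma approximate_eigenvalue_not_uniformly_ergodic:
  fixes S T :: "'a :: banach_lattice operator_family"
  assumes S_add: "\<And>s t. 0 \<le> s \<Longrightarrow> 0 \<le> t \<Longrightarrow> S (s + t) = S s o\<^sub>L S t"
    and real_ops: "\<And>t. 0 \<le> t \<Longrightarrow> real_operator (S t)" "\<And>t. 0 \<le> t \<Longrightarrow> real_operator (T t)"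
    and M: "1 \<le> M" "\<And>t. 0 \<le> t \<Longrightarrow> norm (S t) \<le> M" "\<And>t. 0 \<le> t \<Longrightarrow> norm (T t) \<le> M"
    and pos: "\<And>\<epsilon>. 0 < \<epsilon> \<Longrightarrow> \<exists>t0\<ge>0. \<forall>t\<ge>t0. almost_positive \<epsilon> (T t) \<and> almost_positive \<epsilon> (S t - T t)"
    and eigen: "\<And>\<delta> t. 0 < \<delta> \<Longrightarrow> 0 < t \<Longrightarrow>
      \<exists>z. norm z = 1 \<and> (\<forall>s. 0 \<le> s \<and> s \<le> t \<longrightarrow> norm (T s z - cis (\<beta> * s) *\<^sub>C z) \<le> \<delta>)"
    and mean: "\<And>z \<delta> t. 0 < \<delta> \<Longrightarrow> 0 < t \<Longrightarrow> \<forall>\<^sub>F n in sequentially.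
      norm (\<Sum>k<n. cis (- \<beta> * (real k * (t / real n))) *\<^sub>C S (real k * (t / real n)) z)
        \<le> real n * (K * norm z / t + \<delta>)" and "0 \<le> K"
  shows False
proof -
  \<comment> \<open>The errors below add up to at most \<open>\<delta> * (8 * M\<^sup>2 + 16 * M + 3)\<close>.\<close>
  define \<delta> where "\<delta> = 1 / (28 * M\<^sup>2)"
  have MM: "M \<le> M\<^sup>2" "1 \<le> M\<^sup>2" using M(1) by (auto simp: power2_eq_square intro: order_trans[OF M(1)])
  have \<delta>: "0 < \<delta>" "\<delta> * M\<^sup>2 = 1 / 28" using MM by (auto simp: \<delta>_def)
  have \<delta>M: "\<delta> * M \<le> 1 / 28" "\<delta> \<le> 1 / 28"
    using mult_left_mono[OF MM(1), of \<delta>] mult_left_mono[OF MM(2), of \<delta>] \<delta> by auto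
  obtain \<epsilon>0 where \<epsilon>0: "0 < \<epsilon>0"
      "\<And>(L :: 'a complexification \<Rightarrow>\<^sub>L 'a complexification) f. real_operator L \<Longrightarrow>
        norm L \<le> 2 * M \<Longrightarrow> almost_positive \<epsilon>0 L \<Longrightarrow>
        \<exists>e. norm e \<le> \<delta> * norm f \<and> modulus (L f) \<le> real_restriction L (modulus f) + e"
    using modulus_almost_positive[of "2 * M" \<delta>] M(1) \<delta>(1) by auto
  \<comment> \<open>The bound \<open>\<epsilon>0\<close> serves the modulus estimate; with
    \<open>\<delta> / 2\<close> the errors of \<open>T t\<close> and \<open>S t - T t\<close> add up
    to at most \<open>\<delta>\<close> for \<open>S t\<close>.\<close>
  define \<epsilon> where "\<epsilon> = min \<epsilon>0 (\<delta> / 2)"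
  obtain t0 where t0: "0 \<le> t0"
      "\<And>t. t0 \<le> t \<Longrightarrow> almost_positive \<epsilon> (T t) \<and> almost_positive \<epsilon> (S t - T t)"
    using pos[of \<epsilon>] \<epsilon>0(1) \<delta>(1) by (auto simp: \<epsilon>_def)
  \<comment> \<open>Long enough for the ergodic bound \<open>K / \<tau>\<close> and for the fraction
    of times before \<open>t0\<close> to be at most \<open>\<delta>\<close>; the summand 1 ensures
    positivity.\<close>
  define \<tau> where "\<tau> = (K + t0 + 1) / \<delta>"
  have \<tau>: "0 < \<tau>" "K / \<tau> \<le> \<delta>" "t0 / \<tau> \<le> \<delta>"
    using \<open>0 \<le> K\<close> t0(1) \<delta>(1) by (auto simp: \<tau>_def field_simps)
  obtain m :: nat where m: "1 / \<delta> < real m" using reals_Archimedean2 by blast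
  have m0: "0 < real m" using m \<delta>(1) by (meson divide_pos_pos less_trans zero_less_one)
  have m1: "1 \<le> \<delta> * real m" using m \<delta>(1) by (simp add: field_simps)
  \<comment> \<open>This covers the inner grid on \<open>[0, \<tau>]\<close> as well as the outer
    grid, which starts at \<open>t0\<close> and has length \<open>m * \<tau>\<close>.\<close>
  define \<tau>m where "\<tau>m = t0 + (real m + 1) * \<tau>"
  have "0 < (real m + 1) * \<tau>" using \<tau>(1) by simp
  then have "0 < \<tau>m" using t0(1) by (simp add: \<tau>m_def)
  from eigen[OF \<delta>(1) this] obtain z where z: "norm z = 1"
      "\<And>s. 0 \<le> s \<Longrightarrow> s \<le> \<tau>m \<Longrightarrow> norm (T s z - cis (\<beta> * s) *\<^sub>C z) \<le> \<delta>"
    by blast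
  obtain n1 where n1: "\<And>n. n1 \<le> n \<Longrightarrow>
      norm (\<Sum>k<n. cis (- \<beta> * (real k * (\<tau> / real n))) *\<^sub>C S (real k * (\<tau> / real n)) z)
        \<le> real n * (K * norm z / \<tau> + \<delta>)"
    using mean[OF \<delta>(1) \<tau>(1), of z] unfolding eventually_sequentially by blast
  \<comment> \<open>Besides making the grid fine enough for \<open>z\<close>, this gives
    \<open>1 \<le> \<delta> * n\<close>, which absorbs the extra grid point in
    \<open>sum_few_large_le\<close>.\<close>
  define n where "n = max n1 m"
  have mn: "real m \<le> real n" by (simp add: n_def)
  have n: "0 < real n" "1 \<le> \<delta> * real n"
    using m0 mn order_trans[OF m1 mult_left_mono[OF mn less_imp_le[OF \<delta>(1)]]] by linarith+
  define h where "h = \<tau> / real n"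
  have h: "0 < h" "real n * h = \<tau>" using \<tau>(1) n(1) by (auto simp: h_def)
  define P where "P t = real_restriction (S t)" for t
  define Q where "Q t = real_restriction (T t)" for t
  define u where "u = modulus z"
  have u: "norm u = 1" "0 \<le> u" by (simp_all add: u_def z(1) modulus_nonneg)
  have P_norm: "norm (P t x) \<le> M * norm x" if "0 \<le> t" for t x
    unfolding P_def by (rule order_trans[OF norm_real_restriction mult_right_mono[OF M(2)[OF that] norm_ge_zero]])
  define w where "w t = cis (- \<beta> * t) *\<^sub>C S t z" for t
  define E where "E t = modulus (cis (\<beta> * t) *\<^sub>C z - T t z)" for t
  have E: "norm (E t) \<le> \<delta>" "u \<le> modulus (T t z) + E t" if "0 \<le> t" "t \<le> \<tau>m" for t
  proof -
    show "norm (E t) \<le> \<delta>" using z(2)[OF that] by (simp add: E_def norm_minus_commute)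
    have "u = modulus (T t z + (cis (\<beta> * t) *\<^sub>C z - T t z))" by (simp add: u_def modulus_scaleC)
    also have "\<dots> \<le> modulus (T t z) + E t" unfolding E_def by (rule modulus_add)
    finally show "u \<le> modulus (T t z) + E t" .
  qed
  have tail: "\<exists>e. norm e \<le> \<delta> \<and> modulus (T t z) \<le> Q t u + e"
    "\<exists>e. norm e \<le> \<delta> \<and> modulus (S t z - T t z) \<le> P t u - Q t u + e" if "t0 \<le> t" for t
  proof -
    have t: "0 \<le> t" using that t0(1) by simp
    have "norm (T t) \<le> 2 * M" "norm (S t - T t) \<le> 2 * M"
      using M(1) M(2,3)[OF t] norm_triangle_ineq4[of "S t" "T t"] by auto
    moreover have "almost_positive \<epsilon>0 (T t)" "almost_positive \<epsilon>0 (S t - T t)"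
      using t0(2)[OF that] by (auto intro: almost_positive_mono simp: \<epsilon>_def)
    ultimately show "\<exists>e. norm e \<le> \<delta> \<and> modulus (T t z) \<le> Q t u + e"
      "\<exists>e. norm e \<le> \<delta> \<and> modulus (S t z - T t z) \<le> P t u - Q t u + e"
      using \<epsilon>0(2)[of "T t" z] \<epsilon>0(2)[of "S t - T t" z] real_ops[OF t]
      by (simp_all add: real_operator_diff z(1) u_def P_def Q_def blinfun.diff_left real_restriction_diff_left)
  qed
  have "\<exists>r. norm r \<le> 4 * \<delta> + (if t < t0 then 4 * M else 0) \<and> modulus (w t - z) \<le> P t u - u + r"
    if t: "0 \<le> t" "t \<le> \<tau>m" for t
  proof (cases "t < t0")
    case True
    have "norm (w t) \<le> M"
      using norm_blinfun[of "S t" z] M(2)[OF t(1)] by (simp add: w_def norm_scaleC z(1))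
    then have "norm (w t - z) \<le> M + 1" using norm_triangle_ineq4[of "w t" z] z(1) by simp
    moreover have "norm (P t u - u) \<le> M + 1"
      using norm_triangle_ineq4[of "P t u" u] P_norm[OF t(1), of u] u(1) by simp
    ultimately have "norm (modulus (w t - z) - (P t u - u)) \<le> 4 * M"
      using norm_triangle_ineq4[of "modulus (w t - z)" "P t u - u"] M(1) by simp
    then show ?thesis
      \<comment> \<open>Before \<open>t0\<close> the error is simply the whole discrepancy, of norm
        at most \<open>2 * (M + 1) \<le> 4 * M\<close>.\<close>
      using True \<delta>(1) by (intro exI[of _ "modulus (w t - z) - (P t u - u)"]) simp
  next
    case False
    obtain e e' where e: "norm e \<le> \<delta>" "modulus (T t z) \<le> Q t u + e"
        and e': "norm e' \<le> \<delta>" "modulus (S t z - T t z) \<le> P t u - Q t u + e'"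
      using tail[of t] False by auto
    have "w t - z = cis (- \<beta> * t) *\<^sub>C ((S t z - T t z) - (cis (\<beta> * t) *\<^sub>C z - T t z))"
      by (simp add: w_def scaleC_diff_right scaleC_scaleC scaleC_one cis_mult)
    then have "modulus (w t - z) = modulus ((S t z - T t z) - (cis (\<beta> * t) *\<^sub>C z - T t z))"
      by (simp only: modulus_scaleC norm_cis scaleR_one)
    also have "\<dots> \<le> modulus (S t z - T t z) + E t"
      unfolding E_def by (rule modulus_diff_le)
    also have "\<dots> \<le> (P t u - Q t u + e') + E t" using e'(2) by simp
    \<comment> \<open>The added term is nonnegative because \<open>u\<close> is nearly below
      \<open>Q t u\<close>. It cancels \<open>Q t u\<close>, so the bound involves \<open>S\<close>
      alone.\<close>
    also have "\<dots> \<le> (P t u - Q t u + e') + E t + (Q t u + e + E t - u)"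
    proof (rule add_increasing2[OF _ order_refl])
      show "0 \<le> Q t u + e + E t - u"
        using order_trans[OF E(2)[OF t] add_right_mono[OF e(2)]] by simp
    qed
    also have "\<dots> = P t u - u + (e + e' + E t + E t)" by (simp add: algebra_simps)
    finally have "modulus (w t - z) \<le> P t u - u + (e + e' + E t + E t)" .
    moreover have "norm (e + e' + E t + E t) \<le> \<delta> + \<delta> + \<delta> + \<delta>"
      by (intro order_trans[OF norm_triangle_ineq] add_mono e(1) e'(1) E(1) t)
    ultimately show ?thesis using False by (intro exI[of _ "e + e' + E t + E t"]) simp
  qed
  then obtain r where r: "\<And>t. 0 \<le> t \<Longrightarrow> t \<le> \<tau>m \<Longrightarrow> norm (r t) \<le> 4 * \<delta> + (if t < t0 then 4 * M else 0)"
      "\<And>t. 0 \<le> t \<Longrightarrow> t \<le> \<tau>m \<Longrightarrow> modulus (w t - z) \<le> P t u - u + r t"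
    by metis
  \<comment> \<open>Up to errors, \<open>u\<close> lies below the modulus of \<open>T t z\<close>,
    this below \<open>Q t u\<close>, and this below \<open>P t u\<close>.\<close>
  have "\<exists>g. norm g \<le> 3 * \<delta> \<and> u \<le> P t u + g" if t: "t0 \<le> t" "t \<le> \<tau>m" for t
  proof -
    have t': "0 \<le> t" using t(1) t0(1) by simp
    obtain e where e: "norm e \<le> \<delta>" "modulus (T t z) \<le> Q t u + e" using tail(1)[OF t(1)] by blast
    obtain e' where e': "norm e' \<le> \<epsilon> * norm u" "- e' \<le> real_restriction (S t - T t) u"
      using almost_positiveD[of \<epsilon> "S t - T t" u] t0(2)[OF t(1)] u(2) by blast
    have "Q t u + - e' \<le> Q t u + (P t u - Q t u)"
      using e'(2) by (simp only: add_left_mono real_restriction_diff_left P_def Q_def)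
    then have "Q t u \<le> P t u + e'" by (simp add: algebra_simps)
    then have "u \<le> P t u + e' + e + E t"
      using order_trans[OF E(2)[OF t' t(2)] add_right_mono[OF e(2)]]
      by (meson add_right_mono order_trans)
    moreover have "norm (e' + e + E t) \<le> \<delta> + \<delta> + \<delta>"
      by (intro order_trans[OF norm_triangle_ineq] add_mono e(1) E(1) t t')
        (use e'(1) u(1) \<delta>(1) in \<open>simp add: \<epsilon>_def\<close>)
    ultimately show ?thesis by (intro exI[of _ "e' + e + E t"]) (simp add: add.assoc)
  qed
  then obtain g where g: "\<And>t. t0 \<le> t \<Longrightarrow> t \<le> \<tau>m \<Longrightarrow> norm (g t) \<le> 3 * \<delta>"
      "\<And>t. t0 \<le> t \<Longrightarrow> t \<le> \<tau>m \<Longrightarrow> u \<le> P t u + g t"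
    by metis
  have kh: "0 \<le> real k * h" "real k * h \<le> \<tau>m" if "k < n" for k
  proof -
    show "0 \<le> real k * h" using h(1) by simp
    have "real k * h \<le> \<tau>" using that h mult_right_mono[of "real k" "real n" h] by simp
    also have "\<dots> \<le> (real m + 1) * \<tau>" using \<tau>(1) by simp
    finally show "real k * h \<le> \<tau>m" using t0(1) by (simp add: \<tau>m_def)
  qed
  define s where "s = (\<Sum>k<n. w (real k * h))"
  define R where "R = (\<Sum>k<n. r (real k * h))"
  have s: "norm s \<le> 2 * \<delta> * real n"
  proof -
    have "norm s \<le> real n * (K / \<tau> + \<delta>)"
      using n1[of n] by (simp add: s_def w_def h_def n_def z(1))
    also have "\<dots> \<le> real n * (\<delta> + \<delta>)" using \<tau>(2) by (intro mult_left_mono) auto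
    finally show ?thesis by (simp add: algebra_simps)
  qed
  have R: "norm R \<le> (4 + 8 * M) * \<delta> * real n"
  proof -
    have "norm R \<le> (\<Sum>k<n. 4 * \<delta> + (if real k * h < t0 then 4 * M else 0))"
      unfolding R_def by (intro sum_norm_le r(1) kh) auto
    also have "\<dots> = 4 * \<delta> * real n + (\<Sum>k<n. if real k * h < t0 then 4 * M else 0)"
      by (simp add: sum.distrib)
    also have "\<dots> \<le> 4 * \<delta> * real n + (t0 / h + 1) * (4 * M)"
      using sum_few_large_le[OF h(1) t0(1), of "4 * M" n] M(1) by simp
    also have "\<dots> \<le> 4 * \<delta> * real n + (\<delta> * real n + \<delta> * real n) * (4 * M)"
    proof -
      have "t0 / h = t0 / \<tau> * real n" by (simp add: h_def)
      also have "\<dots> \<le> \<delta> * real n" using \<tau>(3) by (intro mult_right_mono) auto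
      finally show ?thesis using n(2) M(1) by (intro add_left_mono mult_right_mono) auto
    qed
    finally show ?thesis by (simp add: algebra_simps)
  qed
  \<comment> \<open>The summed estimate for \<open>w - z\<close> over the inner grid is stored as a
    single positive element, since almost positive operators can only be applied to positive
    elements.\<close>
  define x where "x = modulus s + (\<Sum>k<n. P (real k * h) u - u) + R - real n *\<^sub>R u"
  have x: "0 \<le> x"
  proof -
    have "real n *\<^sub>R u = modulus (real n *\<^sub>R z)" by (simp add: modulus_scaleR u_def)
    also have "real n *\<^sub>R z = s - (\<Sum>k<n. w (real k * h) - z)"
      by (simp add: s_def sum_subtractf sum_constant_scaleR)
    also have "modulus \<dots> \<le> modulus s + (\<Sum>k<n. modulus (w (real k * h) - z))"
      by (rule order_trans[OF modulus_diff_le add_left_mono[OF modulus_sum]])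
    also have "\<dots> \<le> modulus s + (\<Sum>k<n. P (real k * h) u - u + r (real k * h))"
      by (intro add_left_mono sum_mono r(2) kh) auto
    also have "\<dots> = x + real n *\<^sub>R u" by (simp add: x_def R_def sum.distrib add.assoc)
    finally show ?thesis by simp
  qed
  \<comment> \<open>A crude bound suffices: it enters only through the almost positivity error,
    where it is multiplied by \<open>\<delta>\<close>.\<close>
  have xn: "norm x \<le> 8 * M * real n"
  proof -
    have "norm (\<Sum>k<n. P (real k * h) u - u) \<le> (\<Sum>k<n. M + 1)"
      using P_norm[OF kh(1), of _ u] u(1)
      by (intro sum_norm_le order_trans[OF norm_triangle_ineq4] add_mono) auto
    moreover have "norm x \<le> norm (modulus s) + norm (\<Sum>k<n. P (real k * h) u - u) + norm R + norm (real n *\<^sub>R u)"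
      unfolding x_def
      by (intro order_trans[OF norm_triangle_ineq4] order_trans[OF norm_triangle_ineq] add_mono order_refl)
    ultimately have "norm x \<le> 2 * \<delta> * real n + real n * (M + 1) + (4 + 8 * M) * \<delta> * real n + real n"
      using s R u(1) by simp
    also have "\<dots> = real n * (6 * \<delta> + 8 * (\<delta> * M) + M + 2)" by (simp add: algebra_simps)
    also have "\<dots> \<le> real n * (8 * M)" using \<delta>M M(1) by (intro mult_left_mono) auto
    finally show ?thesis by (simp add: mult_ac)
  qed
  \<comment> \<open>The outer mean has \<open>m\<close> blocks of \<open>n\<close> steps with the
    same width \<open>h\<close>; composing with \<open>P (real k * h)\<close> then becomes an index
    shift by \<open>k\<close>.\<close>
  define N where "N = n * m"
  define \<sigma> where "\<sigma> j = t0 + real j * h" for j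
  have \<sigma>: "t0 \<le> \<sigma> j" "0 \<le> \<sigma> j" for j using h(1) t0(1) by (auto simp: \<sigma>_def)
  have \<sigma>m: "\<sigma> j \<le> \<tau>m" if "j < N" for j
  proof -
    have "real j * h \<le> real N * h" using that h(1) by (intro mult_right_mono) auto
    also have "\<dots> = real m * \<tau>" using h(2) by (simp add: N_def mult_ac)
    also have "\<dots> \<le> (real m + 1) * \<tau>" using \<tau>(1) by simp
    finally show ?thesis by (simp add: \<sigma>_def \<tau>m_def)
  qed
  define v where "v j = P (\<sigma> j) u" for j
  have v: "norm (v j) \<le> M" for j using P_norm[OF \<sigma>(2), of j u] u(1) by (simp add: v_def)
  have shift: "P (\<sigma> j) (P (real k * h) u) = v (j + k)" for j k
  proof -
    have "v (j + k) = real_restriction (S (\<sigma> j + real k * h)) u"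
      by (simp add: v_def P_def \<sigma>_def algebra_simps)
    also have "\<dots> = P (\<sigma> j) (P (real k * h) u)"
      using h(1) \<sigma>(2)[of j] S_add[of "\<sigma> j" "real k * h"] real_restriction_compose[OF real_ops(1)]
      by (simp add: P_def)
    finally show ?thesis ..
  qed
  have "\<exists>e. norm e \<le> \<delta> * norm x \<and> - e \<le> P (\<sigma> j) x" for j
  proof -
    have "almost_positive (\<epsilon> + \<epsilon>) (T (\<sigma> j) + (S (\<sigma> j) - T (\<sigma> j)))"
      using t0(2)[OF \<sigma>(1)] by (intro almost_positive_add) auto
    then have "almost_positive (\<epsilon> + \<epsilon>) (S (\<sigma> j))" by simp
    then have "almost_positive \<delta> (S (\<sigma> j))"
      by (rule almost_positive_mono) (simp add: \<epsilon>_def)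
    then show ?thesis using x by (simp add: almost_positive_def P_def)
  qed
  then obtain e where e: "\<And>j. norm (e j) \<le> \<delta> * norm x" "\<And>j. - e j \<le> P (\<sigma> j) x" by metis
  have Px: "P (\<sigma> j) x = P (\<sigma> j) (modulus s) + (\<Sum>k<n. v (j + k) - v j) + P (\<sigma> j) R - real n *\<^sub>R v j" for j
    unfolding x_def
    by (simp add: real_restriction_linear real_restriction_sum shift[unfolded P_def] v_def[unfolded P_def] P_def)
  define Y where "Y = (\<Sum>j<N. P (\<sigma> j) (modulus s)) + (\<Sum>j<N. \<Sum>k<n. v (j + k) - v j)
    + (\<Sum>j<N. P (\<sigma> j) R) + (\<Sum>j<N. e j) + (\<Sum>j<N. real n *\<^sub>R g (\<sigma> j))"
  have "(\<Sum>j<N. real n *\<^sub>R u) \<le> Y"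
  proof -
    have eP: "0 \<le> e j + P (\<sigma> j) x" for j
      using add_left_mono[OF e(2)[of j], of "e j"] by (simp only: add.right_inverse)
    have "(\<Sum>j<N. real n *\<^sub>R u) \<le> (\<Sum>j<N. real n *\<^sub>R (v j + g (\<sigma> j)))"
      using g(2)[OF \<sigma>(1) \<sigma>m] by (intro sum_mono scaleR_left_mono) (auto simp: v_def)
    also have "\<dots> \<le> (\<Sum>j<N. real n *\<^sub>R (v j + g (\<sigma> j)) + (e j + P (\<sigma> j) x))"
      by (intro sum_mono add_increasing2[OF eP order_refl])
    \<comment> \<open>By \<open>Px\<close>, the terms \<open>real n *\<^sub>R v j\<close>
      cancel.\<close>
    also have "\<dots> = Y"
      by (simp add: Px Y_def sum.distrib sum_subtractf algebra_simps)
    finally show ?thesis .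
  qed
  then have "norm (\<Sum>j<N. real n *\<^sub>R u) \<le> norm Y"
    using u(2) by (intro norm_le_of_nonneg_le sum_nonneg scaleR_nonneg_nonneg) auto
  then have "real N * real n \<le> norm Y"
    using u(1) by (simp add: sum_constant_scaleR)
  also have "\<dots> \<le> real N * (M * (2 * \<delta> * real n)) + real n * (real n * (2 * M))
      + real N * (M * ((4 + 8 * M) * \<delta> * real n)) + real N * (\<delta> * (8 * M * real n))
      + real N * (real n * (3 * \<delta>))"
    unfolding Y_def
  proof (intro order_trans[OF norm_triangle_ineq] add_mono)
    have "norm (P (\<sigma> j) (modulus s)) \<le> M * (2 * \<delta> * real n)" for j
      by (rule order_trans[OF P_norm[OF \<sigma>(2)]]) (use s M(1) in \<open>auto intro: mult_left_mono\<close>)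
    then have "norm (\<Sum>j<N. P (\<sigma> j) (modulus s)) \<le> (\<Sum>j<N. M * (2 * \<delta> * real n))"
      by (intro sum_norm_le) auto
    then show "norm (\<Sum>j<N. P (\<sigma> j) (modulus s)) \<le> real N * (M * (2 * \<delta> * real n))" by simp
    have "norm (P (\<sigma> j) R) \<le> M * ((4 + 8 * M) * \<delta> * real n)" for j
      by (rule order_trans[OF P_norm[OF \<sigma>(2)]]) (use R M(1) in \<open>auto intro: mult_left_mono\<close>)
    then have "norm (\<Sum>j<N. P (\<sigma> j) R) \<le> (\<Sum>j<N. M * ((4 + 8 * M) * \<delta> * real n))"
      by (intro sum_norm_le) auto
    then show "norm (\<Sum>j<N. P (\<sigma> j) R) \<le> real N * (M * ((4 + 8 * M) * \<delta> * real n))" by simp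
    \<comment> \<open>With the summations interchanged, each inner sum is a shift by
      \<open>k \<le> n\<close> and is bounded independently of \<open>N\<close>.\<close>
    have "norm (\<Sum>k<n. \<Sum>j<N. v (j + k) - v j) \<le> (\<Sum>k<n. real n * (2 * M))"
    proof (intro sum_norm_le order_trans[OF norm_shifted_sum_diff_le[OF v]] mult_right_mono)
      show "real k \<le> real n" if "k \<in> {..<n}" for k using that by simp
    qed (use M(1) in simp)
    then show "norm (\<Sum>j<N. \<Sum>k<n. v (j + k) - v j) \<le> real n * (real n * (2 * M))"
      by (subst sum.swap) simp
    have "norm (e j) \<le> \<delta> * (8 * M * real n)" for j
      by (rule order_trans[OF e(1)]) (use xn \<delta>(1) in \<open>auto intro: mult_left_mono\<close>)
    then have "norm (\<Sum>j<N. e j) \<le> (\<Sum>j<N. \<delta> * (8 * M * real n))"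
      by (intro sum_norm_le) auto
    then show "norm (\<Sum>j<N. e j) \<le> real N * (\<delta> * (8 * M * real n))" by simp
    have "norm (\<Sum>j<N. real n *\<^sub>R g (\<sigma> j)) \<le> (\<Sum>j<N. real n * (3 * \<delta>))"
      using g(1)[OF \<sigma>(1) \<sigma>m] by (intro sum_norm_le) (auto intro: mult_left_mono)
    then show "norm (\<Sum>j<N. real n *\<^sub>R g (\<sigma> j)) \<le> real N * (real n * (3 * \<delta>))" by simp
  qed
  \<comment> \<open>The shift error gains the factor \<open>1 / m\<close> relative to
    \<open>N * n\<close>, and \<open>1 / m \<le> \<delta>\<close>.\<close>
  also have "real n * (real n * (2 * M)) \<le> real N * real n * (2 * M * \<delta>)"
  proof -
    have "real n * (real n * (2 * M)) * 1 \<le> real n * (real n * (2 * M)) * (\<delta> * real m)"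
      using m1 M(1) by (intro mult_left_mono) auto
    then show ?thesis by (simp add: N_def mult_ac)
  qed
  finally have "real N * real n * 1 \<le> real N * real n * (\<delta> * (8 * M\<^sup>2 + 16 * M + 3))"
    by (simp add: algebra_simps power2_eq_square)
  moreover have "0 < real N * real n" using n(1) m0 by (simp add: N_def)
  ultimately have "1 \<le> \<delta> * (8 * M\<^sup>2 + 16 * M + 3)" by (simp only: mult_le_cancel_left_pos)
  also have "\<dots> \<le> \<delta> * (27 * M\<^sup>2)" using MM \<delta>(1) by (intro mult_left_mono) auto
  finally show False using \<delta>(2) by simp
qed

section \<open>Rescaled semigroups and their asymptotic positivity\<close>

lemma real_operator_semigroup:
  "C0_semigroup T \<Longrightarrow> real_semigroup T \<Longrightarrow> 0 \<le> t \<Longrightarrow> real_operator (T t)"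
  by (simp add: C0_semigroup_def real_semigroup_def real_operator_def complex_linear_def)

lemma rescale_add:
  assumes "C0_semigroup T" "0 \<le> s" "0 \<le> t"
  shows "rescale T r (s + t) = rescale T r s o\<^sub>L rescale T r t"
  using assms
  by (intro blinfun_eqI)
    (simp add: rescale_def C0_semigroup_def blinfun.scaleR_left blinfun.scaleR_right exp_add exp_diff
      exp_minus divide_inverse distrib_left)

lemma rescale_diff: "rescale T r t = exp ((s - r) * t) *\<^sub>R rescale T s t"
  by (simp add: rescale_def mult_exp_exp algebra_simps)

lemma twist_eq_rescale: "twist l T t f = cis (- Im l * t) *\<^sub>C rescale T (Re l) t f"
proof -
  have "exp (- l * of_real t) = cis (- Im l * t) * of_real (exp (- Re l * t))"
    by (simp add: exp_eq_polar mult.commute)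
  then show ?thesis
    by (simp only: twist_def rescale_def blinfun.scaleR_left flip: scaleC_scaleC scaleC_of_real)
qed

lemma norm_twist_eq_rescale: "norm (twist l T t f) = exp ((r - Re l) * t) * norm (rescale T r t f)"
  by (simp add: twist_eq_rescale norm_scaleC rescale_diff[of T "Re l" t r] blinfun.scaleR_left)

lemma bounded_semigroupD:
  assumes "bounded_semigroup T"
  obtains M where "1 \<le> M" "\<And>t. 0 \<le> t \<Longrightarrow> norm (T t) \<le> M"
proof -
  obtain M where "\<And>t. 0 \<le> t \<Longrightarrow> norm (T t) \<le> M"
    using assms by (auto simp: bounded_semigroup_def bounded_iff)
  then show thesis by (intro that[of "max 1 M"]) (auto simp: le_max_iff_disj)
qed

lemma almost_positive_eventually:
  fixes L :: "'a :: banach_lattice operator_family"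
  assumes "\<And>\<epsilon>. 0 < \<epsilon> \<Longrightarrow> \<exists>t0\<ge>0. \<forall>t\<ge>t0. \<forall>f\<in>positive_cone. infdist (L t f) positive_cone \<le> \<epsilon> * norm f"
    and "0 < \<epsilon>"
  shows "\<exists>t0\<ge>0. \<forall>t\<ge>t0::real. almost_positive \<epsilon> (L t)"
proof -
  obtain t0 where t0: "0 \<le> t0"
      "\<And>t f. t0 \<le> t \<Longrightarrow> f \<in> positive_cone \<Longrightarrow> infdist (L t f) positive_cone \<le> \<epsilon> / 2 * norm f"
    using assms(1)[of "\<epsilon> / 2"] assms(2) by auto
  have "almost_positive (2 * (\<epsilon> / 2)) (L t)" if "t0 \<le> t" for t
    by (rule almost_positiveI_infdist) (use t0(2)[OF that] assms(2) in auto)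
  then show ?thesis using t0(1) by auto
qed

lemma uniformly_asymptotically_positiveD:
  assumes "uniformly_asymptotically_positive T"
  obtains r M where "spectral_bound (generator T) = ereal r" "1 \<le> M"
    "\<And>t. 0 \<le> t \<Longrightarrow> norm (rescale T r t) \<le> M"
    "\<And>\<epsilon>. 0 < \<epsilon> \<Longrightarrow> \<exists>t0\<ge>0. \<forall>t\<ge>t0. almost_positive \<epsilon> (rescale T r t)"
proof -
  obtain r where r: "spectral_bound (generator T) = ereal r"
    using assms unfolding uniformly_asymptotically_positive_def by (auto elim: abs_neq_infinity_cases)
  have "bounded_semigroup (rescale T r)" and
    "\<And>\<epsilon>. 0 < \<epsilon> \<Longrightarrow> \<exists>t0\<ge>0. \<forall>t\<ge>t0. \<forall>f\<in>positive_cone.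
      infdist (rescale T r t f) positive_cone \<le> \<epsilon> * norm f"
    using assms by (simp_all add: uniformly_asymptotically_positive_def Let_def r)
  with that[OF r] show thesis
    using almost_positive_eventually[of "rescale T r"] by (metis bounded_semigroupD)
qed

section \<open>Spectral points on the boundary and lower norm bounds\<close>

lemma spectrum_le_spectral_bound:
  "l \<in> spectrum A \<Longrightarrow> spectral_bound A = ereal r \<Longrightarrow> Re l \<le> r"
  unfolding spectral_bound_def by (metis SUP_upper ereal_less_eq(3))

lemma in_closure_resolvent_setI:
  assumes "\<And>e. 0 < e \<Longrightarrow> l + of_real e \<notin> spectrum A"
  shows "l \<in> closure (resolvent_set A)"
  unfolding closure_approachable
proof (intro allI impI)
  fix e :: real assume "0 < e"
  then show "\<exists>\<mu>\<in>resolvent_set A. dist \<mu> l < e"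
    using assms[of "e / 2"] by (intro bexI[of _ "l + of_real (e / 2)"])
      (auto simp: spectrum_def dist_norm norm_divide)
qed

text \<open>An eigenvector defect below \<open>\<delta> / (M * t)\<close> accumulates to at most
  \<open>\<delta>\<close> up to time \<open>t\<close>.\<close>

lemma approximate_twist_eigenvector:
  assumes T: "C0_semigroup T"
    and l: "l \<in> spectrum (generator T)" "l \<in> closure (resolvent_set (generator T))"
    and M: "0 < M" "\<And>s g. 0 \<le> s \<Longrightarrow> s \<le> t \<Longrightarrow> norm (twist l T s g) \<le> M * norm g"
    and "0 < \<delta>" "0 < t"
  shows "\<exists>f. norm f = 1 \<and> (\<forall>s. 0 \<le> s \<and> s \<le> t \<longrightarrow> norm (f - twist l T s f) \<le> \<delta>)"
proof -
  obtain f a where f: "generator T f = Some a" "norm f = 1" "norm (l *\<^sub>C f - a) < \<delta> / (M * t)"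
    using approximate_eigenvector[OF l, of "\<delta> / (M * t)"] M(1) \<open>0 < \<delta>\<close> \<open>0 < t\<close> by auto
  have "norm (f - twist l T s f) \<le> \<delta>" if s: "0 \<le> s" "s \<le> t" for s
  proof -
    have "norm (f - twist l T s f) \<le> M * s * norm (l *\<^sub>C f - a)"
      using s(2) by (intro norm_diff_twist_le[OF T f(1) s(1)] M(2)) auto
    also have "\<dots> \<le> M * t * (\<delta> / (M * t))"
      using s M(1) f(3) by (intro mult_mono) auto
    also have "\<dots> = \<delta>" using M(1) \<open>0 < t\<close> by simp
    finally show ?thesis .
  qed
  then show ?thesis using f(2) by blast
qed

text \<open>Moving from \<open>l\<close> to the right, the last spectral point on the horizontal
  line exists because the spectrum is closed and bounded in that direction. Everything beyond it on
  the line is in the resolvent set.\<close>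

lemma boundary_of_spectrum_right:
  assumes "l \<in> spectrum (generator T)" "spectral_bound (generator T) = ereal r"
  obtains l' where "l' \<in> spectrum (generator T)" "l' \<in> closure (resolvent_set (generator T))"
    "Re l \<le> Re l'" "Re l' \<le> r"
proof -
  define X where "X = (\<lambda>x. Complex x (Im l)) -` spectrum (generator T)"
  have "closed (spectrum (generator T))"
    using open_resolvent_set by (simp add: spectrum_def closed_def)
  then have X: "closed X"
    unfolding X_def
    by (rule closed_vimage) (simp add: Complex_eq, intro continuous_intros)
  have l: "Re l \<in> X" using assms(1) by (simp add: X_def)
  have le: "x \<le> r" if "x \<in> X" for x
    using spectrum_le_spectral_bound[OF _ assms(2), of "Complex x (Im l)"] that by (simp add: X_def)
  have bdd: "bdd_above X" using le by (rule bdd_aboveI)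
  define x where "x = Sup X"
  have x: "x \<in> X" unfolding x_def using closed_contains_Sup[OF _ bdd X] l by blast
  show thesis
  proof (rule that[of "Complex x (Im l)"])
    show "Complex x (Im l) \<in> spectrum (generator T)" using x by (simp add: X_def)
    show "Complex x (Im l) \<in> closure (resolvent_set (generator T))"
    proof (rule in_closure_resolvent_setI)
      fix e :: real assume "0 < e"
      then have "x + e \<notin> X" using cSup_upper[OF _ bdd, of "x + e"] by (auto simp: x_def)
      then show "Complex x (Im l) + of_real e \<notin> spectrum (generator T)"
        by (simp add: X_def complex_of_real_def plus_complex.ctr)
    qed
    show "Re l \<le> Re (Complex x (Im l))" using cSup_upper[OF l bdd] by (simp add: x_def)
    show "Re (Complex x (Im l)) \<le> r" using le[OF x] by simp
  qed
qed

text \<open>Approximate eigenvectors at spectral points near the abscissa \<open>r\<close> are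
  almost preserved in norm up to time \<open>t\<close>. A norm of at most 1/2 would shrink them too
  much.\<close>

lemma norm_rescale_gt_half:
  assumes T: "C0_semigroup T" and r: "spectral_bound (generator T) = ereal r"
    and bdd: "bounded_semigroup (rescale T r)" and "0 < t"
  shows "1 / 2 < norm (rescale T r t)"
proof (rule ccontr)
  assume "\<not> 1 / 2 < norm (rescale T r t)"
  then have half: "norm (rescale T r t) \<le> 1 / 2" by simp
  obtain M where M: "1 \<le> M" "\<And>s. 0 \<le> s \<Longrightarrow> norm (rescale T r s) \<le> M"
    using bounded_semigroupD[OF bdd] by metis
  \<comment> \<open>The spectral bound need not be attained. A gap below \<open>1 / (4 * t)\<close>
    changes norms up to time \<open>t\<close> by a factor of at most
    \<open>exp (1 / 4) \<le> 4 / 3\<close>.\<close>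
  have "ereal (r - 1 / (4 * t)) < (SUP l\<in>spectrum (generator T). ereal (Re l))"
    using r \<open>0 < t\<close> by (simp add: spectral_bound_def)
  then obtain l where l: "l \<in> spectrum (generator T)" "r - 1 / (4 * t) < Re l"
    unfolding less_SUP_iff by auto
  obtain l' where l': "l' \<in> spectrum (generator T)" "l' \<in> closure (resolvent_set (generator T))"
      "Re l \<le> Re l'" "Re l' \<le> r"
    using boundary_of_spectrum_right[OF l(1) r] .
  have gap: "(r - Re l') * t \<le> 1 / 4"
  proof -
    have "(r - Re l') * t \<le> 1 / (4 * t) * t"
      using l(2) l'(3) \<open>0 < t\<close> by (intro mult_right_mono) auto
    then show ?thesis using \<open>0 < t\<close> by simp
  qed
  have "exp (- (1 / 4)) \<ge> (3 / 4 :: real)" using exp_ge_add_one_self[of "- (1 / 4)"] by simp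
  then have "3 / 4 * exp (1 / 4) \<le> exp (- (1 / 4)) * exp (1 / 4 :: real)"
    by (intro mult_right_mono) simp_all
  also have "\<dots> = 1" by (simp flip: exp_add)
  finally have "exp (1 / 4) \<le> (4 / 3 :: real)" by linarith
  then have e: "exp ((r - Re l') * s) \<le> 4 / 3" if "0 \<le> s" "s \<le> t" for s
    by (rule order_trans[rotated])
      (use gap mult_left_mono[OF that(2), of "r - Re l'"] l'(4) in auto)
  have tw: "norm (twist l' T s g) \<le> 4 / 3 * M * norm g" if "0 \<le> s" "s \<le> t" for s g
  proof -
    have "norm (rescale T r s g) \<le> M * norm g"
      by (rule order_trans[OF norm_blinfun mult_right_mono[OF M(2)[OF that(1)] norm_ge_zero]])
    then have "exp ((r - Re l') * s) * norm (rescale T r s g) \<le> 4 / 3 * (M * norm g)"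
      by (intro mult_mono e that) auto
    then show ?thesis by (simp add: norm_twist_eq_rescale[of _ _ _ _ r])
  qed
  obtain f where f: "norm f = 1" "norm (f - twist l' T t f) \<le> 1 / 8"
    using approximate_twist_eigenvector[OF T l'(1,2) _ tw, of t "1 / 8"] M(1) \<open>0 < t\<close> by auto
  have "norm (rescale T r t f) \<le> 1 / 2" using norm_blinfun[of "rescale T r t" f] half f(1) by simp
  then have "exp ((r - Re l') * t) * norm (rescale T r t f) \<le> 4 / 3 * (1 / 2)"
    using e[of t] \<open>0 < t\<close> by (intro mult_mono) auto
  then have "norm (twist l' T t f) \<le> 2 / 3" by (simp add: norm_twist_eq_rescale[of _ _ _ _ r])
  \<comment> \<open>A unit vector moved by at most 1/8 has norm at least 7/8, which exceeds
    2/3.\<close>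
  then show False using f norm_triangle_ineq2[of f "twist l' T t f"] by simp
qed

text \<open>One factor 2 comes from splitting into positive and negative parts, the other from
  splitting into real and imaginary parts.\<close>

lemma norm_real_operator_le:
  assumes L: "real_operator L" and C: "0 \<le> C"
    and pos: "\<And>x. 0 \<le> x \<Longrightarrow> norm (real_restriction L x) \<le> C * norm x"
  shows "norm L \<le> 4 * C"
proof (rule norm_blinfun_bound)
  fix f
  have real: "norm (real_restriction L x) \<le> 2 * C * norm x" for x
  proof -
    have p: "0 \<le> pprt x" "0 \<le> - nprt x" by simp_all
    have "norm (pprt x) \<le> norm \<bar>x\<bar>" "norm (- nprt x) \<le> norm \<bar>x\<bar>"
      by (rule norm_le_of_nonneg_le[OF p(1)], simp add: abs_prts)
        (rule norm_le_of_nonneg_le[OF p(2)], simp add: abs_prts)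
    then have "C * norm (pprt x) \<le> C * norm x" "C * norm (- nprt x) \<le> C * norm x"
      using C by (auto intro: mult_left_mono)
    moreover have "real_restriction L x = real_restriction L (pprt x) - real_restriction L (- nprt x)"
      using prts[of x] by (simp flip: real_restriction_linear)
    then have "norm (real_restriction L x)
        \<le> norm (real_restriction L (pprt x)) + norm (real_restriction L (- nprt x))"
      by (simp only: norm_triangle_ineq4)
    ultimately show ?thesis
      using pos[OF p(1)] pos[OF p(2)] by linarith
  qed
  have "norm (L f) \<le> norm (real_restriction L (Rpart f)) + norm (real_restriction L (Ipart f))"
    using norm_complexification_le[of "L f"] by (subst (asm) (2 3) real_operator_apply[OF L]) simp
  also have "\<dots> \<le> 2 * C * norm f + 2 * C * norm f"
    using C by (intro add_mono order_trans[OF real] mult_left_mono norm_Rpart_le norm_Ipart_le) auto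
  finally show "norm (L f) \<le> 4 * C * norm f" by simp
qed (use C in simp)

text \<open>If \<open>s(B) < s(A)\<close>, then \<open>e\<^sup>t\<^sup>(\<^sup>A\<^sup>-\<^sup>s\<^sup>(\<^sup>A\<^sup>)\<^sup>)\<close> is squeezed between \<open>0\<close> and
  \<open>e\<^sup>t\<^sup>(\<^sup>B\<^sup>-\<^sup>s\<^sup>(\<^sup>A\<^sup>)\<^sup>)\<close> asymptotically and thus tends to \<open>0\<close>.\<close>

lemma spectral_bound_mono_of_domination:
  fixes TA TB :: "'a :: banach_lattice operator_family"
  assumes A: "C0_semigroup TA" "real_semigroup TA"
    and a: "spectral_bound (generator TA) = ereal a" "bounded_semigroup (rescale TA a)"
    and posA: "\<And>\<epsilon>. 0 < \<epsilon> \<Longrightarrow> \<exists>t0\<ge>0. \<forall>t\<ge>t0. almost_positive \<epsilon> (rescale TA a t)"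
    and M: "1 \<le> M" "\<And>t. 0 \<le> t \<Longrightarrow> norm (rescale TB b t) \<le> M"
    and dom: "\<And>\<epsilon>. 0 < \<epsilon> \<Longrightarrow> \<exists>t0\<ge>0. \<forall>t\<ge>t0. almost_positive \<epsilon> (rescale TB b t - rescale TA b t)"
  shows "a \<le> b"
proof (rule ccontr)
  assume "\<not> a \<le> b"
  then have ab: "0 < a - b" by simp
  obtain t1 where t1: "0 \<le> t1" "\<And>t. t1 \<le> t \<Longrightarrow> almost_positive (1 / 32) (rescale TA a t)"
    using posA[of "1 / 32"] by auto
  obtain t2 where t2: "0 \<le> t2"
      "\<And>t. t2 \<le> t \<Longrightarrow> almost_positive (1 / 32) (rescale TB b t - rescale TA b t)"
    using dom[of "1 / 32"] by auto
  \<comment> \<open>The logarithm makes the decay factor \<open>q\<close> beat the bound of the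
    dominating semigroup: \<open>q * M \<le> 1 / 16\<close>.\<close>
  define t where "t = max 1 (max (max t1 t2) (ln (16 * M) / (a - b)))"
  have t: "0 < t" "t1 \<le> t" "t2 \<le> t" "ln (16 * M) / (a - b) \<le> t" by (simp_all add: t_def)
  define q where "q = exp ((b - a) * t)"
  have q: "0 < q" "q \<le> 1" "q * M \<le> 1 / 16"
  proof -
    show "0 < q" by (simp add: q_def)
    show "q \<le> 1" using ab t(1) by (simp add: q_def mult_le_0_iff)
    have "ln (16 * M) \<le> (a - b) * t" using t(4) ab by (simp add: pos_divide_le_eq mult.commute)
    then have "exp (ln (16 * M)) \<le> exp ((a - b) * t)" by simp
    then have "16 * M \<le> inverse q" using M(1) by (simp add: q_def algebra_simps flip: exp_minus)
    then show "q * M \<le> 1 / 16" using \<open>0 < q\<close> by (simp add: field_simps)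
  qed
  \<comment> \<open>The constant is 1/32 + 1/16 + 1/32, from the lower error, the decaying upper
    bound and the domination error. The resulting norm bound 1/2 contradicts
    \<open>norm_rescale_gt_half\<close>.\<close>
  have "norm (rescale TA a t) \<le> 4 * (1 / 8)"
  proof (rule norm_real_operator_le)
    show "real_operator (rescale TA a t)"
      unfolding rescale_def using A t(1) by (intro real_operator_scaleR real_operator_semigroup) auto
  next
    fix x :: 'a assume x: "0 \<le> x"
    define y where "y = real_restriction (rescale TA a t) x"
    define p where "p = real_restriction (rescale TB b t) x"
    have y: "y = q *\<^sub>R real_restriction (rescale TA b t) x"
      by (simp add: y_def q_def rescale_diff[of TA a t b] real_restriction_scaleR_left)
    obtain e where e: "norm e \<le> 1 / 32 * norm x" "- e \<le> y"
      using almost_positiveD[OF t1(2)[OF t(2)] x] unfolding y_def .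
    obtain e' where e': "norm e' \<le> 1 / 32 * norm x"
        "- e' \<le> real_restriction (rescale TB b t - rescale TA b t) x"
      using almost_positiveD[OF t2(2)[OF t(3)] x] .
    have "q *\<^sub>R - e' \<le> q *\<^sub>R (p - real_restriction (rescale TA b t) x)"
      using e'(2) q(1) unfolding p_def by (intro scaleR_left_mono) (simp_all add: real_restriction_diff_left)
    then have up: "y \<le> q *\<^sub>R p + q *\<^sub>R e'" by (simp add: y algebra_simps)
    have "\<bar>y\<bar> \<le> \<bar>e\<bar> + \<bar>q *\<^sub>R p\<bar> + \<bar>q *\<^sub>R e'\<bar>"
      unfolding bl_abs_le
    proof
      have "q *\<^sub>R p + q *\<^sub>R e' \<le> \<bar>q *\<^sub>R p\<bar> + \<bar>q *\<^sub>R e'\<bar>" by (intro add_mono abs_ge_self)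
      also have "\<dots> \<le> \<bar>e\<bar> + (\<bar>q *\<^sub>R p\<bar> + \<bar>q *\<^sub>R e'\<bar>)" by (simp add: add_increasing)
      finally show "y \<le> \<bar>e\<bar> + \<bar>q *\<^sub>R p\<bar> + \<bar>q *\<^sub>R e'\<bar>"
        using up by (simp add: add.assoc)
      have "- y \<le> e" using e(2) by (simp add: minus_le_iff)
      also have "\<dots> \<le> \<bar>e\<bar>" by (rule abs_ge_self)
      also have "\<dots> \<le> \<bar>e\<bar> + (\<bar>q *\<^sub>R p\<bar> + \<bar>q *\<^sub>R e'\<bar>)" by (simp add: add_increasing2)
      finally show "- y \<le> \<bar>e\<bar> + \<bar>q *\<^sub>R p\<bar> + \<bar>q *\<^sub>R e'\<bar>" by (simp add: add.assoc)
    qed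
    then have "norm y \<le> norm (\<bar>e\<bar> + \<bar>q *\<^sub>R p\<bar> + \<bar>q *\<^sub>R e'\<bar>)" by (rule bl_norm_mono)
    also have "\<dots> \<le> norm \<bar>e\<bar> + norm \<bar>q *\<^sub>R p\<bar> + norm \<bar>q *\<^sub>R e'\<bar>"
      by (intro order_trans[OF norm_triangle_ineq] add_mono order_refl)
    also have "\<dots> \<le> 1 / 32 * norm x + 1 / 16 * norm x + 1 / 32 * norm x"
    proof (intro add_mono)
      show "norm \<bar>e\<bar> \<le> 1 / 32 * norm x" using e(1) by simp
      have "norm p \<le> M * norm x"
        unfolding p_def
        using t(1) by (intro order_trans[OF norm_real_restriction] mult_right_mono M(2)) auto
      then have "q * norm p \<le> (q * M) * norm x"
        using q(1) by (simp add: mult.assoc)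
      also have "\<dots> \<le> 1 / 16 * norm x" using q(3) by (intro mult_right_mono) auto
      finally show "norm \<bar>q *\<^sub>R p\<bar> \<le> 1 / 16 * norm x" using q(1) by simp
      have "q * norm e' \<le> 1 * (1 / 32 * norm x)" using q e'(1) by (intro mult_mono) auto
      then show "norm \<bar>q *\<^sub>R e'\<bar> \<le> 1 / 32 * norm x" using q(1) by simp
    qed
    finally show "norm (real_restriction (rescale TA a t) x) \<le> 1 / 8 * norm x" by (simp add: y_def)
  qed simp
  then show False using norm_rescale_gt_half[OF A(1) a t(1)] by simp
qed

section \<open>The inclusion in the peripheral spectrum\<close>

theorem theorem5p4:
  fixes TA TB :: "real \<Rightarrow> 'a :: banach_lattice complexification \<Rightarrow>\<^sub>L 'a complexification"
  assumes "C0_semigroup TA" and "C0_semigroup TB"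
    and "real_semigroup TA" and "real_semigroup TB"
    and "uniformly_asymptotically_positive TA" and "uniformly_asymptotically_positive TB"
    and "uniformly_asymptotically_dominates TB TA"
  shows "spectrum (generator TA) \<inter> {l. ereal (Re l) = spectral_bound (generator TB)}
     \<subseteq> peripheral_spectrum (generator TB)"
proof (rule subsetI, rule ccontr)
  obtain a MA where a: "spectral_bound (generator TA) = ereal a" "1 \<le> MA"
      "\<And>t. 0 \<le> t \<Longrightarrow> norm (rescale TA a t) \<le> MA"
      "\<And>\<epsilon>. 0 < \<epsilon> \<Longrightarrow> \<exists>t0\<ge>0. \<forall>t\<ge>t0. almost_positive \<epsilon> (rescale TA a t)"
    using uniformly_asymptotically_positiveD[OF assms(5)] by metis
  obtain b MB where b: "spectral_bound (generator TB) = ereal b" "1 \<le> MB"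
      "\<And>t. 0 \<le> t \<Longrightarrow> norm (rescale TB b t) \<le> MB"
    using uniformly_asymptotically_positiveD[OF assms(6)] by metis
  have dom: "\<exists>t0\<ge>0. \<forall>t\<ge>t0. almost_positive \<epsilon> (rescale TB b t - rescale TA b t)" if "0 < \<epsilon>" for \<epsilon>
    using almost_positive_eventually[of "\<lambda>t. rescale TB b t - rescale TA b t" \<epsilon>] assms(7) that
    by (simp add: uniformly_asymptotically_dominates_def b(1) Let_def blinfun.diff_left)
  have bdd: "bounded_semigroup (rescale TA a)"
    using a(3) by (auto simp: bounded_semigroup_def bounded_iff)
  fix l
  assume "l \<in> spectrum (generator TA) \<inter> {l. ereal (Re l) = spectral_bound (generator TB)}"
  then have l: "l \<in> spectrum (generator TA)" "Re l = b" by (simp_all add: b(1))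
  assume "l \<notin> peripheral_spectrum (generator TB)"
  then have rho: "l \<in> resolvent_set (generator TB)"
    using l(2) by (simp add: peripheral_spectrum_def b(1) spectrum_def)
  \<comment> \<open>Domination gives \<open>a \<le> b\<close>; the spectral point \<open>l\<close>
    of \<open>A\<close> with real part \<open>b\<close> gives the converse.\<close>
  have "a = b"
    using spectral_bound_mono_of_domination[OF assms(1,3) a(1) bdd a(4) b(2,3) dom]
      spectrum_le_spectral_bound[OF l(1) a(1)] l(2) by auto
  note a = a[unfolded \<open>a = b\<close>]
  \<comment> \<open>Points to the right of \<open>l\<close> have real part above the spectral bound
    of \<open>A\<close>, so they approach \<open>l\<close> through the resolvent set.\<close>
  have closure: "l \<in> closure (resolvent_set (generator TA))"
    using spectrum_le_spectral_bound[OF _ a(1)] l(2) by (intro in_closure_resolvent_setI) fastforce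
  obtain c where c: "0 < c"
      "\<And>f g. generator TB f = Some g \<Longrightarrow> c * norm f \<le> norm (l *\<^sub>C f - g)"
      "\<And>z. \<exists>f g. generator TB f = Some g \<and> l *\<^sub>C f - g = z"
    using rho unfolding resolvent_set_generator_iff by blast
  define M where "M = max MA MB"
  have M: "1 \<le> M" "\<And>t. 0 \<le> t \<Longrightarrow> norm (rescale TB b t) \<le> M" "\<And>t. 0 \<le> t \<Longrightarrow> norm (rescale TA b t) \<le> M"
    using a(2,3) b(2,3) by (auto simp: M_def le_max_iff_disj)
  have tw: "norm (twist l T s g) \<le> M * norm g"
    if "\<And>t. 0 \<le> t \<Longrightarrow> norm (rescale T b t) \<le> M" "0 \<le> s" for T s and g :: "'a complexification"
    using order_trans[OF norm_blinfun mult_right_mono[OF that(1)[OF that(2)] norm_ge_zero]]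
    by (simp add: twist_eq_rescale norm_scaleC l(2))
  show False
  \<comment> \<open>The lower bound \<open>c\<close> for \<open>l - B\<close> gives a preimage of
    \<open>z\<close> of norm at most \<open>norm z / c\<close>, so \<open>K\<close> is uniform in
    \<open>z\<close>.\<close>
  proof (rule approximate_eigenvalue_not_uniformly_ergodic[where S = "rescale TB b" and T = "rescale TA b"
        and \<beta> = "Im l" and K = "(1 + M) / c"])
    show "rescale TB b (s + t) = rescale TB b s o\<^sub>L rescale TB b t" if "0 \<le> s" "0 \<le> t" for s t
      by (rule rescale_add[OF assms(2) that])
    show "real_operator (rescale TB b t)" "real_operator (rescale TA b t)" if "0 \<le> t" for t
      unfolding rescale_def using assms that
      by (auto intro!: real_operator_scaleR real_operator_semigroup)
    show "\<exists>t0\<ge>0. \<forall>t\<ge>t0. almost_positive \<epsilon> (rescale TA b t) \<and>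
        almost_positive \<epsilon> (rescale TB b t - rescale TA b t)" if \<epsilon>: "0 < \<epsilon>" for \<epsilon>
    proof -
      obtain t1 t2 where "0 \<le> t1" "\<forall>t\<ge>t1. almost_positive \<epsilon> (rescale TA b t)"
          "\<forall>t\<ge>t2. almost_positive \<epsilon> (rescale TB b t - rescale TA b t)"
        using a(4)[OF \<epsilon>] dom[OF \<epsilon>] by blast
      then show ?thesis by (intro exI[of _ "max t1 t2"]) auto
    qed
    show "\<exists>z. norm z = 1 \<and> (\<forall>s. 0 \<le> s \<and> s \<le> t \<longrightarrow>
        norm (rescale TA b s z - cis (Im l * s) *\<^sub>C z) \<le> \<delta>)" if "0 < \<delta>" "0 < t" for \<delta> t
    proof -
      have "norm (rescale TA b s z - cis (Im l * s) *\<^sub>C z) = norm (z - twist l TA s z)" for s z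
      proof -
        have "z - twist l TA s z = cis (- Im l * s) *\<^sub>C (cis (Im l * s) *\<^sub>C z - rescale TA b s z)"
          by (simp add: twist_eq_rescale l(2) scaleC_diff_right scaleC_scaleC cis_mult scaleC_one)
        then show ?thesis by (simp only: norm_scaleC norm_cis mult_1 norm_minus_commute)
      qed
      then show ?thesis
        using approximate_twist_eigenvector[OF assms(1) l(1) closure _ tw[OF M(3)] that] M(1) by simp
    qed
    show "\<forall>\<^sub>F n in sequentially.
        norm (\<Sum>k<n. cis (- Im l * (real k * (t / real n))) *\<^sub>C rescale TB b (real k * (t / real n)) z)
          \<le> real n * ((1 + M) / c * norm z / t + \<delta>)" if "0 < \<delta>" "0 < t" for z \<delta> t
    proof -
      obtain f g where f: "generator TB f = Some g" "l *\<^sub>C f - g = z" using c(3) by blast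
      have "norm f \<le> norm z / c" using c(2)[OF f(1)] f(2) c(1) by (simp add: field_simps)
      then have "(1 + M) * norm f / t \<le> (1 + M) * (norm z / c) / t"
        using M(1) that(2) by (intro divide_right_mono mult_left_mono) auto
      then have "real n * ((1 + M) * norm f / t + \<delta>) \<le> real n * ((1 + M) / c * norm z / t + \<delta>)" for n
        by (intro mult_left_mono) auto
      then show ?thesis
        using mean_twist_le[OF assms(2) f(1) that(2,1) _ tw[OF M(2)]] M(1)
        unfolding f(2) twist_eq_rescale l(2)
        by (auto elim!: eventually_mono intro: order_trans)
    qed
  qed (use M c(1) in auto)
qed

end
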